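(* Let $G$ be a weighted graph with a countable vertex set $V(G)$ and let $\omega>0$. Assume that $f\in PW_\omega(G)$ and that $S\subset V(G)$ is a sampling set for $PW_\omega(G)$. Let $g(t,v)$ be the solution of the Cauchy problem $$\frac{dg(t,v)}{dt}=i\Delta g(t,v),\qquad g(0,v)=f(v),\qquad v\in V(G),\ t\in\mathbb{R}.$$ Then $g(t,v)$ at any point $(t,v)\in\mathbb{R}\times V(G)$ is completely determined by the values of $\Delta f$ on $S$ and by the set of samples $g(k\pi/\omega,s)$, $k\in\mathbb{N}\cup\{0\}$, $s\in S$. Moreover, the explicit reconstruction formula is given by $$g(t,v)=\sum_{s\in S}\left(it\,\mathrm{sinc}\left(\frac{\omega t}{\pi}\right)(\Delta f)(s)+\mathrm{sinc}\left(\frac{\omega t}{\pi}\right)g(0,s)\right)\Phi_s(v)+\sum_{s\in S}\left(\sum_{k\in\mathbb{N},\,k\neq0}\frac{\omega t}{k\pi}\,\mathrm{sinc}\left(\frac{\omega t}{\pi}-k\right)g\left(\frac{k\pi}{\omega},s\right)\right)\Phi_s(v),$$ where $g(0,s)=f(s)$ and $\{\Phi_s\}_{s\in S}$ is a frame in $PW_\omega(G)$ such that $h(v)=\sum_{s\in S}h(s)\Phi_s(v)$ for all $h\in PW_\omega(G)$ and $v\in V(G)$.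
   Context: The graph $G$ has a countable vertex set $V(G)$; $w(u,v)$ is the weight of the edge connecting $u$ and $v$, and the degree $\mu(v)$ is the sum of the weights of the edges incident to $v$. $L_2(G)$ is the Hilbert space of complex-valued functions on $V(G)$ with inner product $\langle f,g\rangle=\sum_{v\in V(G)}f(v)\overline{g(v)}\,\mu(v)$ (and finite norm). The Laplace operator is $(\Delta f)(v)=\sum_{u\in V(G)}(f(v)-f(u))w(v,u)$, regarded as a positive-semidefinite self-adjoint operator in $L_2(G)$. For $f$ in the domain of $\Delta$ the unique solution of the Cauchy problem is $g(t,v)=e^{it\Delta}f(v)$, where $e^{it\Delta}$ is a group of unitary operators in $L_2(G)$. By the spectral theorem every function in $L_2(G)$ is identified with a measure on the nonnegative semiaxis; $PW_\omega(G)$, $\omega>0$, is the set of $f\in L_2(G)$ whose measure (with respect to $\Delta$) is supported in $[0,\omega]$. A set $S\subset V(G)$ is a sampling set for $PW_\omega(G)$ if there are constants $c,C>0$ with $c\|f\|^2\le\sum_{s\in S}|f(s)|^2\le C\|f\|^2$ for all $f\in PW_\omega(G)$; for such $S$ a frame $\{\Phi_s\}_{s\in S}$ in $PW_\omega(G)$ with the reconstruction property in the claim exists. A frame in a Hilbert space $H$ is a family $\{\Phi_s\}\subset H$ with $A\|h\|^2\le\sum_s|\langle h,\Phi_s\rangle|^2\le B\|h\|^2$ for all $h\in H$ and some $A,B>0$. $\mathrm{sinc}(x)=\frac{\sin\pi x}{\pi x}$ for $x\ne0$ and $\mathrm{sinc}(0)=1$.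
   Formalization: In the reconstruction formula the inner sum runs over all nonzero integers k instead of k∈ℕ, k≠0; the printed formula is false, e.g. for nonzero constant f on a finite regular graph its right side is 0 at t=−π/ω. *)

theory Defs
  imports "HOL-Analysis.Analysis"
begin

section \<open>Weighted graphs and the space of square-summable functions\<close>

definition vdeg :: "('v \<Rightarrow> 'v \<Rightarrow> real) \<Rightarrow> 'v \<Rightarrow> real" where
  "vdeg w v = (\<Sum>\<^sub>\<infinity>u. w v u)"

text \<open>The vertex set is a whole type. Local finiteness is not required, only finite degrees.
  Degrees are positive, since otherwise the form \<open>l2_inner\<close> below is degenerate and the
  square-summable functions are not a Hilbert space of functions. A loop counts once in the
  degree.\<close>

definition weighted_graph :: "('v \<Rightarrow> 'v \<Rightarrow> real) \<Rightarrow> bool" where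
  "weighted_graph w \<longleftrightarrow>
     (\<forall>u v. 0 \<le> w u v) \<and> (\<forall>u v. w u v = w v u) \<and>
     (\<forall>v. w v summable_on UNIV) \<and> (\<forall>v. 0 < vdeg w v)"

definition L2 :: "('v \<Rightarrow> 'v \<Rightarrow> real) \<Rightarrow> ('v \<Rightarrow> complex) set" where
  "L2 w = {f. (\<lambda>v. (cmod (f v))\<^sup>2 * vdeg w v) summable_on UNIV}"

definition l2_inner :: "('v \<Rightarrow> 'v \<Rightarrow> real) \<Rightarrow> ('v \<Rightarrow> complex) \<Rightarrow> ('v \<Rightarrow> complex) \<Rightarrow> complex" where
  "l2_inner w f g = (\<Sum>\<^sub>\<infinity>v. f v * cnj (g v) * of_real (vdeg w v))"

definition l2_norm :: "('v \<Rightarrow> 'v \<Rightarrow> real) \<Rightarrow> ('v \<Rightarrow> complex) \<Rightarrow> real" where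
  "l2_norm w f = sqrt (Re (l2_inner w f f))"

section \<open>The Laplace operator\<close>

definition laplace :: "('v \<Rightarrow> 'v \<Rightarrow> real) \<Rightarrow> ('v \<Rightarrow> complex) \<Rightarrow> 'v \<Rightarrow> complex" where
  "laplace w f v = (\<Sum>\<^sub>\<infinity>u. (f v - f u) * of_real (w v u))"

definition l2_dense_subspace :: "('v \<Rightarrow> 'v \<Rightarrow> real) \<Rightarrow> ('v \<Rightarrow> complex) set \<Rightarrow> bool" where
  "l2_dense_subspace w D \<longleftrightarrow>
     D \<subseteq> L2 w \<and> (\<lambda>v. 0) \<in> D \<and>
     (\<forall>f\<in>D. \<forall>g\<in>D. (\<lambda>v. f v + g v) \<in> D) \<and>
     (\<forall>f\<in>D. \<forall>a. (\<lambda>v. a * f v) \<in> D) \<and>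
     (\<forall>f\<in>L2 w. \<forall>e>0. \<exists>g\<in>D. l2_norm w (\<lambda>v. f v - g v) < e)"

definition adjoint_domain ::
  "('v \<Rightarrow> 'v \<Rightarrow> real) \<Rightarrow> ('v \<Rightarrow> complex) set \<Rightarrow> (('v \<Rightarrow> complex) \<Rightarrow> 'v \<Rightarrow> complex) \<Rightarrow> ('v \<Rightarrow> complex) set"
where
  "adjoint_domain w D A =
     {g \<in> L2 w. \<exists>h\<in>L2 w. \<forall>f\<in>D. l2_inner w (A f) g = l2_inner w f h}"

text \<open>The possibly unbounded operator \<open>A\<close> with domain \<open>D\<close> is self-adjoint: it is symmetric and
  the domain of its adjoint is \<open>D\<close>.\<close>

definition selfadjoint ::
  "('v \<Rightarrow> 'v \<Rightarrow> real) \<Rightarrow> ('v \<Rightarrow> complex) set \<Rightarrow> (('v \<Rightarrow> complex) \<Rightarrow> 'v \<Rightarrow> complex) \<Rightarrow> bool"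
where
  "selfadjoint w D A \<longleftrightarrow>
     l2_dense_subspace w D \<and> (\<forall>f\<in>D. A f \<in> L2 w) \<and>
     (\<forall>f\<in>D. \<forall>g\<in>D. l2_inner w (A f) g = l2_inner w f (A g)) \<and>
     adjoint_domain w D A = D"

text \<open>\<open>D\<close> is a domain on which the Laplace operator is a positive-semidefinite self-adjoint
  operator.\<close>

definition laplace_domain :: "('v \<Rightarrow> 'v \<Rightarrow> real) \<Rightarrow> ('v \<Rightarrow> complex) set \<Rightarrow> bool" where
  "laplace_domain w D \<longleftrightarrow>
     selfadjoint w D (laplace w) \<and> (\<forall>f\<in>D. 0 \<le> Re (l2_inner w (laplace w f) f))"

section \<open>Spectral measures and Paley-Wiener spaces\<close>

definition orthogonal_projection ::
  "('v \<Rightarrow> 'v \<Rightarrow> real) \<Rightarrow> (('v \<Rightarrow> complex) \<Rightarrow> 'v \<Rightarrow> complex) \<Rightarrow> bool"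
where
  "orthogonal_projection w P \<longleftrightarrow>
     (\<forall>f\<in>L2 w. P f \<in> L2 w \<and> P (P f) = P f) \<and>
     (\<forall>f\<in>L2 w. \<forall>g\<in>L2 w. P (\<lambda>v. f v + g v) = (\<lambda>v. P f v + P g v)) \<and>
     (\<forall>f\<in>L2 w. \<forall>a. P (\<lambda>v. a * f v) = (\<lambda>v. a * P f v)) \<and>
     (\<forall>f\<in>L2 w. \<forall>g\<in>L2 w. l2_inner w (P f) g = l2_inner w f (P g))"

definition projection_valued_measure ::
  "('v \<Rightarrow> 'v \<Rightarrow> real) \<Rightarrow> (real set \<Rightarrow> ('v \<Rightarrow> complex) \<Rightarrow> 'v \<Rightarrow> complex) \<Rightarrow> bool"
where
  "projection_valued_measure w E \<longleftrightarrow>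
     (\<forall>B\<in>sets borel. orthogonal_projection w (E B)) \<and>
     (\<forall>f\<in>L2 w. E UNIV f = f) \<and>
     (\<forall>A\<in>sets borel. \<forall>B\<in>sets borel. \<forall>f\<in>L2 w. E (A \<inter> B) f = E A (E B f)) \<and>
     (\<forall>B. range B \<subseteq> sets borel \<longrightarrow> disjoint_family B \<longrightarrow>
        (\<forall>f\<in>L2 w.
           (\<lambda>n. l2_norm w (\<lambda>v. E (\<Union>i::nat. B i) f v - (\<Sum>i<n. E (B i) f v)))
             \<longlonglongrightarrow> 0))"

definition spectral_measure ::
  "('v \<Rightarrow> 'v \<Rightarrow> real) \<Rightarrow> (real set \<Rightarrow> ('v \<Rightarrow> complex) \<Rightarrow> 'v \<Rightarrow> complex) \<Rightarrow> ('v \<Rightarrow> complex) \<Rightarrow> real measure"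
where
  "spectral_measure w E f =
     measure_of UNIV (sets borel) (\<lambda>B. ennreal (Re (l2_inner w (E B f) f)))"

text \<open>\<open>E\<close> is the resolution of the identity of the operator \<open>A\<close> with domain \<open>D\<close>, that is,
  \<open>A\<close> is the integral of the identity function with respect to \<open>E\<close>. The quadratic form
  determines \<open>A\<close> by polarization.\<close>

definition spectral_resolution ::
  "('v \<Rightarrow> 'v \<Rightarrow> real) \<Rightarrow> ('v \<Rightarrow> complex) set \<Rightarrow> (('v \<Rightarrow> complex) \<Rightarrow> 'v \<Rightarrow> complex) \<Rightarrow>
     (real set \<Rightarrow> ('v \<Rightarrow> complex) \<Rightarrow> 'v \<Rightarrow> complex) \<Rightarrow> bool"
where
  "spectral_resolution w D A E \<longleftrightarrow>
     projection_valued_measure w E \<and>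
     D = {f \<in> L2 w. (\<integral>\<^sup>+x. ennreal (x\<^sup>2) \<partial>spectral_measure w E f) < \<infinity>} \<and>
     (\<forall>f\<in>D. l2_inner w (A f) f = of_real (\<integral>x. x \<partial>spectral_measure w E f))"

text \<open>By the spectral theorem a self-adjoint operator has exactly one resolution of the identity
  (up to its values outside the Borel sets and \<open>L2 w\<close>), so the existential quantifier only names
  it. The measure of \<open>f\<close> is supported in the closed set \<open>{0..\<omega>}\<close> iff the complement is null.\<close>

definition PW :: "('v \<Rightarrow> 'v \<Rightarrow> real) \<Rightarrow> ('v \<Rightarrow> complex) set \<Rightarrow> real \<Rightarrow> ('v \<Rightarrow> complex) set" where
  "PW w D \<omega> =
     {f \<in> L2 w. \<exists>E. spectral_resolution w D (laplace w) E \<and>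
        emeasure (spectral_measure w E f) (- {0..\<omega>}) = 0}"

section \<open>Sampling sets and frames\<close>

definition sampling_set ::
  "('v \<Rightarrow> 'v \<Rightarrow> real) \<Rightarrow> ('v \<Rightarrow> complex) set \<Rightarrow> real \<Rightarrow> 'v set \<Rightarrow> bool"
where
  "sampling_set w D \<omega> S \<longleftrightarrow>
     (\<exists>c>0. \<exists>C>0. \<forall>f\<in>PW w D \<omega>.
        (\<lambda>s. (cmod (f s))\<^sup>2) summable_on S \<and>
        c * (l2_norm w f)\<^sup>2 \<le> (\<Sum>\<^sub>\<infinity>s\<in>S. (cmod (f s))\<^sup>2) \<and>
        (\<Sum>\<^sub>\<infinity>s\<in>S. (cmod (f s))\<^sup>2) \<le> C * (l2_norm w f)\<^sup>2)"

definition frame_in ::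
  "('v \<Rightarrow> 'v \<Rightarrow> real) \<Rightarrow> ('v \<Rightarrow> complex) set \<Rightarrow> 'i set \<Rightarrow> ('i \<Rightarrow> 'v \<Rightarrow> complex) \<Rightarrow> bool"
where
  "frame_in w H S \<Phi> \<longleftrightarrow>
     (\<forall>s\<in>S. \<Phi> s \<in> H) \<and>
     (\<exists>a>0. \<exists>b>0. \<forall>h\<in>H.
        (\<lambda>s. (cmod (l2_inner w h (\<Phi> s)))\<^sup>2) summable_on S \<and>
        a * (l2_norm w h)\<^sup>2 \<le> (\<Sum>\<^sub>\<infinity>s\<in>S. (cmod (l2_inner w h (\<Phi> s)))\<^sup>2) \<and>
        (\<Sum>\<^sub>\<infinity>s\<in>S. (cmod (l2_inner w h (\<Phi> s)))\<^sup>2) \<le> b * (l2_norm w h)\<^sup>2)"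

definition reconstructing ::
  "('v \<Rightarrow> complex) set \<Rightarrow> 'v set \<Rightarrow> ('v \<Rightarrow> 'v \<Rightarrow> complex) \<Rightarrow> bool"
where
  "reconstructing H S \<Phi> \<longleftrightarrow> (\<forall>h\<in>H. \<forall>v. ((\<lambda>s. h s * \<Phi> s v) has_sum h v) S)"

section \<open>The Cauchy problem\<close>

text \<open>The time derivative is taken in the norm of \<open>L2 w\<close>.\<close>

definition cauchy_solution ::
  "('v \<Rightarrow> 'v \<Rightarrow> real) \<Rightarrow> ('v \<Rightarrow> complex) set \<Rightarrow> ('v \<Rightarrow> complex) \<Rightarrow> (real \<Rightarrow> 'v \<Rightarrow> complex) \<Rightarrow> bool"
where
  "cauchy_solution w D f g \<longleftrightarrow>
     (\<forall>t. g t \<in> D) \<and>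
     (\<forall>t. ((\<lambda>h. l2_norm w (\<lambda>v. (g (t + h) v - g t v) / of_real h - \<i> * laplace w (g t) v))
             \<longlongrightarrow> 0) (at 0)) \<and>
     g 0 = f"

text \<open>Valiron-Tschakaloff interpolation of a function of exponential type at most \<open>\<omega>\<close>, bounded on
  the real line, needs its samples at \<open>k * pi / \<omega>\<close> for all integers \<open>k\<close>: a series with \<open>k > 0\<close> only
  vanishes at every \<open>t = - m * pi / \<omega>\<close>, \<open>m \<ge> 1\<close>.\<close>

definition sinc :: "real \<Rightarrow> real" where
  "sinc x = (if x = 0 then 1 else sin (pi * x) / (pi * x))"

end

(* Spectral projections of cells of width \<delta> cut a solution g with spectrum in [0, \<omega>] into pieces on
   which the Laplacian is a scalar up to \<delta>. The pieces are thus nearly multiples of exp (\<i> * \<lambda> * t)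
   with \<lambda> in [0, \<omega>], for which the interpolation formula is an absolutely convergent Fourier series
   in \<lambda>; letting \<delta> tend to 0 gives the formula at every vertex. Both of its summands lie in the
   Paley-Wiener space, so the frame reconstructs them from S. For the determination, the sample at
   time 0 already fixes f, and the norm of a solution is constant. *)
theory Submission
  imports Defs
begin

section \<open>Fourier uniqueness on the circle\<close>

text \<open>With x = \<lambda> / \<omega> and \<tau> = \<omega> t / pi, the exponential exp (i
  \<lambda> t) becomes exp (i pi \<tau> x) and its sample at time k pi / \<omega> becomes exp (i pi
  k x), so interpolation in t is a Fourier expansion in x on [-1, 1]. The plain expansion has
  coefficients sinc (\<tau> - k), of order 1/k, and at x = 1 it converges to the mean of the two end
  values; yet \<omega> itself may carry spectral mass. Subtracting a multiple of 1 + i pi \<tau> x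
  removes the jump, improves the coefficients to order 1/k^2, and is the origin of the term with
  \<Delta> f. A second obstacle is that a spectral resolution describes \<Delta> only through its
  quadratic form. That \<Delta> commutes with the projections and is nearly scalar on a narrow range
  is derived from the form, and solutions are compared with exponentials through the differential
  equation, in place of a functional calculus.\<close>

definition exp_orthogonal :: "(real \<Rightarrow> complex) \<Rightarrow> bool" where
  "exp_orthogonal \<psi> \<longleftrightarrow> continuous_on {-1..1} \<psi> \<and>
     (\<forall>k::int. ((\<lambda>x. \<psi> x * cis (pi * of_int k * x)) has_integral 0) {-1..1})"

lemma exp_orthogonal_add:
  assumes "exp_orthogonal \<phi>" "exp_orthogonal \<psi>"
  shows "exp_orthogonal (\<lambda>x. \<phi> x + \<psi> x)"
proof -
  have "((\<lambda>x. (\<phi> x + \<psi> x) * cis (pi * of_int k * x)) has_integral 0) {-1..1}" for k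
    using has_integral_add[of "\<lambda>x. \<phi> x * cis (pi * of_int k * x)" 0 "{-1..1}"
        "\<lambda>x. \<psi> x * cis (pi * of_int k * x)" 0] assms
    by (simp add: exp_orthogonal_def distrib_right)
  then show ?thesis
    using assms by (auto simp: exp_orthogonal_def intro!: continuous_intros)
qed

lemma exp_orthogonal_scale:
  assumes "exp_orthogonal \<psi>" shows "exp_orthogonal (\<lambda>x. \<psi> x * c)"
proof -
  have "((\<lambda>x. \<psi> x * c * cis (pi * of_int k * x)) has_integral 0) {-1..1}" for k
    using has_integral_mult_left[of "\<lambda>x. \<psi> x * cis (pi * of_int k * x)" 0 "{-1..1}" c] assms
    by (simp add: exp_orthogonal_def mult.assoc mult.commute[of c])
  then show ?thesis
    using assms by (auto simp: exp_orthogonal_def intro!: continuous_intros)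
qed

lemma exp_orthogonal_shift:
  assumes "exp_orthogonal \<psi>" shows "exp_orthogonal (\<lambda>x. \<psi> x * cis (pi * of_int m * x))"
proof -
  have "((\<lambda>x. \<psi> x * cis (pi * of_int m * x) * cis (pi * of_int k * x)) has_integral 0) {-1..1}" for k
  proof -
    have "((\<lambda>x. \<psi> x * cis (pi * of_int (m + k) * x)) has_integral 0) {-1..1}"
      using assms unfolding exp_orthogonal_def by blast
    then show ?thesis
      by (simp add: mult.assoc cis_mult algebra_simps)
  qed
  then show ?thesis
    using assms by (auto simp: exp_orthogonal_def cis_conv_exp intro!: continuous_intros)
qed

text \<open>On the unit circle a polynomial in the two real coordinates is a trigonometric
  polynomial, so multiplying by it only mixes frequencies. \<psi> is generalized because a product
  is absorbed into it one factor at a time.\<close>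

lemma exp_orthogonal_polynomial:
  assumes "real_polynomial_function p" "exp_orthogonal \<psi>"
  shows "exp_orthogonal (\<lambda>x. \<psi> x * of_real (p (cis (pi * x))))"
  using assms
proof (induction arbitrary: \<psi> rule: real_polynomial_function.induct)
  case (linear L)
  have L: "L z = Re z * L 1 + Im z * L \<i>" for z
  proof -
    interpret bounded_linear L by fact
    have "z = Re z *\<^sub>R 1 + Im z *\<^sub>R \<i>"
      by (simp add: complex_eq_iff)
    then have "L z = L (Re z *\<^sub>R 1 + Im z *\<^sub>R \<i>)"
      by simp
    then show ?thesis
      by (simp add: add scaleR)
  qed
  \<comment> \<open>On the circle, Re z = (z + cnj z) / 2 and Im z = (z - cnj z) / (2 i);
    \<open>a\<close> and \<open>b\<close> collect the coefficients of z and cnj z.\<close>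
  define a b where "a = (L 1 - \<i> * L \<i>) / 2" and "b = (L 1 + \<i> * L \<i>) / 2"
  have "of_real (L (cis (pi * x))) = cis (pi * of_int 1 * x) * a + cis (pi * of_int (-1) * x) * b" for x
    by (subst L) (simp add: a_def b_def complex_eq_iff field_simps)
  moreover have "exp_orthogonal (\<lambda>x. \<psi> x * cis (pi * of_int 1 * x) * a + \<psi> x * cis (pi * of_int (-1) * x) * b)"
    by (intro exp_orthogonal_add exp_orthogonal_scale exp_orthogonal_shift linear.prems)
  ultimately show ?case
    by (simp add: distrib_left mult.assoc)
next
  case (const c)
  then show ?case by (rule exp_orthogonal_scale)
next
  case (add f g)
  then show ?case
    using exp_orthogonal_add by (simp add: distrib_left)
next
  case (mult f g)
  then show ?case
    by (simp flip: mult.assoc)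
qed

text \<open>Stone-Weierstrass on the circle replaces \<rho> by a polynomial at a cost of at most sup
  |\<psi>| * e times the interval length 2.\<close>

lemma exp_orthogonal_continuous:
  assumes \<psi>: "exp_orthogonal \<psi>" and \<rho>: "continuous_on (sphere 0 1) \<rho>"
  shows "((\<lambda>x. \<psi> x * of_real (\<rho> (cis (pi * x)))) has_integral 0) {-1..1}"
proof -
  have c\<psi>: "continuous_on {-1..1} \<psi>"
    using \<psi> by (simp add: exp_orthogonal_def)
  obtain M where "\<forall>x\<in>{-1..1}. norm (\<psi> x) \<le> M"
    using compact_imp_bounded[OF compact_continuous_image[OF c\<psi>]] by (auto simp: bounded_iff)
  then have M: "norm (\<psi> x) \<le> M" if "x \<in> {-1..1}" for x
    using that by blast
  have M0: "M \<ge> 0"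
    using norm_ge_zero[of "\<psi> 0"] M[of 0] by (simp del: norm_ge_zero)
  have c: "continuous_on {-1..1} (\<lambda>x. \<psi> x * of_real (\<rho> (cis (pi * x))))"
    by (intro continuous_intros c\<psi> continuous_on_compose2[OF \<rho>]) (auto simp: cis_conv_exp intro!: continuous_intros)
  define I where "I = integral {-1..1} (\<lambda>x. \<psi> x * of_real (\<rho> (cis (pi * x))))"
  have hI: "((\<lambda>x. \<psi> x * of_real (\<rho> (cis (pi * x)))) has_integral I) {-1..1}"
    unfolding I_def using c by (intro integrable_integral integrable_continuous_interval)
  have bound: "norm I \<le> M * e * 2" if "e > 0" for e
  proof -
    obtain p where p: "real_polynomial_function p" "\<And>z. z \<in> sphere 0 1 \<Longrightarrow> \<bar>\<rho> z - p z\<bar> < e"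
      using Stone_Weierstrass_real_polynomial_function[of "sphere 0 1" \<rho> e] \<rho> \<open>e > 0\<close> by auto
    have *: "exp_orthogonal (\<lambda>x. \<psi> x * of_real (p (cis (pi * x))))"
      using exp_orthogonal_polynomial[OF p(1) \<psi>] .
    then have "((\<lambda>x. \<psi> x * of_real (p (cis (pi * x))) * cis (pi * of_int 0 * x)) has_integral 0) {-1..1}"
      unfolding exp_orthogonal_def by blast
    from has_integral_diff[OF hI this]
    have "((\<lambda>x. \<psi> x * of_real (\<rho> (cis (pi * x)) - p (cis (pi * x)))) has_integral I) {-1..1}"
      by (simp add: algebra_simps)
    moreover have "norm (\<psi> x * of_real (\<rho> (cis (pi * x)) - p (cis (pi * x)))) \<le> M * e"
      if "x \<in> {-1..1}" for x
      unfolding norm_mult norm_of_real using M[OF that] p(2)[of "cis (pi * x)"] M0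
      by (intro mult_mono) auto
    ultimately show ?thesis
      using has_integral_bound[of "M * e" "\<lambda>x. \<psi> x * of_real (\<rho> (cis (pi * x)) - p (cis (pi * x)))" I "-1" 1] M0 \<open>e > 0\<close>
      by (simp del: of_real_diff)
  qed
  have "I = 0"
  proof (rule ccontr)
    assume "I \<noteq> 0"
    then have pos: "norm I > 0" by simp
    show False
      \<comment> \<open>This choice gives norm I \<le> M / (M + 1) * norm I; the summand 1 keeps the
        divisor positive when M = 0.\<close>
      using bound[of "norm I / (2 * (M + 1))"] M0 pos by (simp add: field_simps)
  qed
  then show ?thesis using hI by simp
qed

text \<open>The angle is plus or minus arccos (Re z) on the upper and lower half circle. The two
  branches meet at z = 1, where both angles are 0, and at z = -1, where the periodicity of \<psi> is
  used.\<close>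

lemma continuous_on_circle_lift:
  fixes \<psi> :: "real \<Rightarrow> 'a::topological_space"
  assumes c: "continuous_on {-1..1} \<psi>" and per: "\<psi> (-1) = \<psi> 1"
  obtains \<Psi> where "continuous_on (sphere 0 1) \<Psi>" "\<And>x. x \<in> {-1..1} \<Longrightarrow> \<Psi> (cis (pi * x)) = \<psi> x"
proof
  define \<Psi> where "\<Psi> z = (if Im z \<le> 0 then \<psi> (- arccos (Re z) / pi) else \<psi> (arccos (Re z) / pi))" for z
  have Re1: "\<bar>Re z\<bar> \<le> 1" if "z \<in> sphere 0 1" for z
    using that abs_Re_le_cmod[of z] by simp
  have arc: "continuous_on (sphere 0 1) (\<lambda>z. arccos (Re z))"
    using Re1 by (intro continuous_on_arccos continuous_intros) (auto simp: abs_le_iff)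
  have arc_le: "arccos (Re z) / pi \<in> {0..1}" if "z \<in> sphere 0 1" for z
    using Re1[OF that] by (auto simp: abs_le_iff arccos_lbound arccos_ubound)
  have arc1: "continuous_on A (\<lambda>z. arccos (Re z) / pi)" "continuous_on A (\<lambda>z. - arccos (Re z) / pi)"
    if "A \<subseteq> sphere 0 1" for A
    using continuous_on_subset[OF arc that]
    by (auto intro!: continuous_on_divide continuous_on_minus continuous_on_const)
  show "continuous_on (sphere 0 1) \<Psi>"
    unfolding \<Psi>_def
  proof (intro continuous_on_cases_le)
    show "continuous_on {t \<in> sphere 0 1. Im t \<le> 0} (\<lambda>z. \<psi> (- arccos (Re z) / pi))"
      using arc_le by (intro continuous_on_compose2[OF c] arc1) (fastforce dest: arc_le)+
    show "continuous_on {t \<in> sphere 0 1. 0 \<le> Im t} (\<lambda>z. \<psi> (arccos (Re z) / pi))"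
      using arc_le by (intro continuous_on_compose2[OF c] arc1) (fastforce dest: arc_le)+
    show "continuous_on (sphere 0 1) Im"
      by (intro continuous_intros)
    fix z assume z: "z \<in> sphere (0::complex) 1" "Im z = 0"
    then have "\<bar>Re z\<bar> = 1"
      by (simp add: cmod_eq_Re)
    then have "Re z = 1 \<or> Re z = -1"
      by auto
    then show "\<psi> (- arccos (Re z) / pi) = \<psi> (arccos (Re z) / pi)"
      using per by auto
  qed
  show "\<Psi> (cis (pi * x)) = \<psi> x" if x: "x \<in> {-1..1}" for x
  proof (cases "x = 0 \<or> x = 1 \<or> x = -1")
    case True
    then show ?thesis using per by (auto simp: \<Psi>_def)
  next
    case False
    show ?thesis
    proof (cases "x > 0")
      case True
      then have "sin (pi * x) > 0"
        using x False by (intro sin_gt_zero) auto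
      moreover have "arccos (cos (pi * x)) = pi * x"
        using True x by (intro arccos_cos) auto
      ultimately show ?thesis by (simp add: \<Psi>_def)
    next
      case xn: False
      define y where "y = - x"
      have y: "0 < y" "y < 1"
        using x False xn by (auto simp: y_def)
      have "sin (pi * y) > 0" "arccos (cos (pi * y)) = pi * y"
        using y by (auto intro!: sin_gt_zero arccos_cos)
      then show ?thesis by (simp add: \<Psi>_def y_def)
    qed
  qed
qed

text \<open>\<psi> is tested against its own real and imaginary parts, lifted to the circle. This
  makes the integrals of (Re \<psi>)^2 and (Im \<psi>)^2 vanish, and the integrands are
  continuous.\<close>

lemma exp_orthogonal_eq_0:
  assumes \<psi>: "exp_orthogonal \<psi>" and per: "\<psi> (-1) = \<psi> 1" and x: "x \<in> {-1..1}"
  shows "\<psi> x = 0"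
proof -
  have c\<psi>: "continuous_on {-1..1} \<psi>"
    using \<psi> by (simp add: exp_orthogonal_def)
  obtain \<Psi> where \<Psi>: "continuous_on (sphere 0 1) \<Psi>" "\<And>x. x \<in> {-1..1} \<Longrightarrow> \<Psi> (cis (pi * x)) = \<psi> x"
    using continuous_on_circle_lift[OF c\<psi> per] by blast
  have part: "L (\<psi> x) = 0"
    if L: "bounded_linear L" "\<And>z r. L (z * of_real r) = L z * r" for L
  proof -
    have "((\<lambda>x. \<psi> x * of_real (L (\<Psi> (cis (pi * x))))) has_integral 0) {-1..1}"
      by (intro exp_orthogonal_continuous[OF \<psi>] bounded_linear.continuous_on[OF L(1)] \<Psi>)
    then have "((\<lambda>x. \<psi> x * of_real (L (\<psi> x))) has_integral 0) {-1..1}"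
      by (rule has_integral_eq[rotated]) (simp add: \<Psi>)
    from has_integral_linear[OF this L(1)]
    have "((\<lambda>x. (L (\<psi> x))\<^sup>2) has_integral 0) (cbox (-1) 1)"
      using L(1) by (simp add: o_def L(2) power2_eq_square bounded_linear.linear linear_0)
    then have "(L (\<psi> x))\<^sup>2 = 0"
      using x bounded_linear.continuous_on[OF L(1) c\<psi>]
      by (intro has_integral_0_cbox_imp_0[where f="\<lambda>x. (L (\<psi> x))\<^sup>2"]) (auto intro!: continuous_intros)
    then show ?thesis by simp
  qed
  show ?thesis
    using part[OF bounded_linear_Re] part[OF bounded_linear_Im] by (simp add: complex_eq_iff)
qed

section \<open>The Valiron-Tschakaloff formula for exponentials\<close>

lemma summable_on_inverse_squares_int: "(\<lambda>k::int. 1 / (of_int k)\<^sup>2 :: real) summable_on - {0}"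
proof -
  let ?f = "\<lambda>k::int. 1 / (of_int k)\<^sup>2 :: real"
  have "summable (\<lambda>n. norm (1 / (real (Suc n))\<^sup>2))"
    using inverse_power_summable[of 2, where 'a=real] 
    by (subst summable_Suc_iff) (simp add: inverse_eq_divide)
  then have n: "(\<lambda>n. 1 / (real (Suc n))\<^sup>2) summable_on UNIV"
    by (rule norm_summable_imp_summable_on)
  have pos: "?f summable_on {0<..}"
  proof -
    have "k \<in> range (\<lambda>n. int (Suc n))" if "k > 0" for k
      using that by (intro image_eqI[of _ _ "nat (k - 1)"]) auto
    then have "{0<..} = (\<lambda>n. int (Suc n)) ` UNIV"
      by fastforce
    moreover have "?f \<circ> (\<lambda>n. int (Suc n)) = (\<lambda>n. 1 / (real (Suc n))\<^sup>2)"
      by (auto simp: o_def)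
    ultimately show ?thesis
      using n by (simp add: summable_on_reindex inj_on_def del: of_nat_Suc)
  qed
  have eq: "?f \<circ> uminus = ?f"
    by auto
  have "?f summable_on uminus ` {(0::int)<..}"
    unfolding summable_on_reindex[OF inj_uminus] eq by (rule pos)
  then have neg: "?f summable_on {..<0}"
    by simp
  have "- {0} = {..<0} \<union> {(0::int)<..}"
    by auto
  moreover have "{..<0} \<inter> {(0::int)<..} = {}"
    by auto
  ultimately show ?thesis
    using summable_on_Un_disjoint[OF neg pos] by simp
qed

lemma abs_sinc_le_1: "\<bar>sinc x\<bar> \<le> 1"
proof (cases "x = 0")
  case False
  have "\<bar>sin (pi * x)\<bar> \<le> \<bar>pi * x\<bar>"
    by (rule abs_sin_x_le_abs_x)
  then show ?thesis
    using False by (simp add: sinc_def abs_mult)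
qed (simp add: sinc_def)

text \<open>The weight of the k-th sample in Valiron-Tschakaloff interpolation, in the normalized
  time \<tau> = \<omega> t / pi. At k = 0 division by zero makes it 0.\<close>

definition vt_coeff :: "real \<Rightarrow> int \<Rightarrow> real" where
  "vt_coeff \<tau> k = \<tau> / of_int k * sinc (\<tau> - of_int k)"

text \<open>One power of 1/k is explicit. The other comes from |k| \<le> |\<tau>| + |\<tau> - k|
  together with |sinc| \<le> 1 and |\<tau> - k| |sinc (\<tau> - k)| \<le> 1.\<close>

lemma abs_vt_coeff_le: "\<bar>vt_coeff \<tau> k\<bar> \<le> \<bar>\<tau>\<bar> * (\<bar>\<tau>\<bar> + 1) * (1 / (of_int k)\<^sup>2)"
proof (cases "k = 0")
  case False
  let ?s = "sinc (\<tau> - of_int k)"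
  have "\<bar>\<tau> - of_int k\<bar> * \<bar>?s\<bar> \<le> 1"
    using order_trans[OF abs_sin_le_one[of "pi * (\<tau> - of_int k)"], of pi] pi_ge_two
    by (auto simp: sinc_def abs_mult divide_simps)
  moreover have "\<bar>\<tau>\<bar> * \<bar>?s\<bar> \<le> \<bar>\<tau>\<bar>"
    using abs_sinc_le_1[of "\<tau> - of_int k"] by (simp add: mult_left_le)
  moreover have "\<bar>of_int k\<bar> * \<bar>?s\<bar> \<le> (\<bar>\<tau>\<bar> + \<bar>\<tau> - of_int k\<bar>) * \<bar>?s\<bar>"
    by (intro mult_right_mono) auto
  ultimately have "\<bar>of_int k\<bar> * \<bar>?s\<bar> \<le> \<bar>\<tau>\<bar> + 1"
    by (simp add: distrib_right)
  then have "\<bar>\<tau>\<bar> * (\<bar>of_int k\<bar> * \<bar>?s\<bar>) \<le> \<bar>\<tau>\<bar> * (\<bar>\<tau>\<bar> + 1)"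
    by (intro mult_left_mono) auto
  moreover have "\<bar>vt_coeff \<tau> k\<bar> = \<bar>\<tau>\<bar> * (\<bar>of_int k\<bar> * \<bar>?s\<bar>) * (1 / (\<bar>of_int k\<bar> * \<bar>of_int k\<bar>))"
    using False unfolding vt_coeff_def abs_mult abs_divide by (simp del: abs_mult_self_eq)
  moreover have "\<bar>of_int k\<bar> * \<bar>of_int k\<bar> = (of_int k :: real)\<^sup>2"
    by (simp only: abs_mult_self_eq power2_eq_square)
  ultimately show ?thesis
    by (metis mult_right_mono zero_le_divide_1_iff zero_le_power2)
qed (simp add: vt_coeff_def)

lemma summable_on_vt_coeff: "(\<lambda>k. \<bar>vt_coeff \<tau> k\<bar>) summable_on - {0}"
  using summable_on_comparison_test[OF summable_on_cmult_right[OF summable_on_inverse_squares_int] abs_vt_coeff_le]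
  by simp

lemma has_integral_cis_int:
  "((\<lambda>x. cis (pi * a * x)) has_integral of_real (2 * sinc a)) {-1..1}"
proof (cases "a = 0")
  case True
  then show ?thesis
    using has_integral_const_real[of "1::complex" "-1" 1] by (simp add: sinc_def scaleR_conv_of_real)
next
  case False
  have "((\<lambda>x. cis (pi * a * x)) has_integral
      (cis (pi * a * 1) / (\<i> * of_real (pi * a)) - cis (pi * a * (-1)) / (\<i> * of_real (pi * a)))) {-1..1}"
    using False
    unfolding cis_conv_exp of_real_mult
    by (intro fundamental_theorem_of_calculus
          has_vector_derivative_real_field[where f="\<lambda>z. exp (\<i> * (of_real pi * of_real a * z)) / (\<i> * (of_real pi * of_real a))"])
       (auto intro!: derivative_eq_intros simp: field_simps)
  moreover have "cis (pi * a * 1) - cis (pi * a * (-1)) = \<i> * of_real (pi * a) * of_real (2 * sinc a)"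
    using False by (simp add: sinc_def complex_eq_iff)
  ultimately show ?thesis
    using False by (simp flip: diff_divide_distrib)
qed

lemma has_integral_id_cis_int:
  assumes "k \<noteq> (0::int)"
  shows "((\<lambda>x. of_real x * cis (pi * of_int k * x)) has_integral - 2 * \<i> * of_real (cos (pi * of_int k) / (pi * of_int k))) {-1..1}"
proof -
  define c where "c = pi * of_int k"
  have c: "c \<noteq> 0" using assms by (simp add: c_def)
  \<comment> \<open>The equations a d = 1 and a + b d = 0 make (z a + b) exp (z d) a primitive of z
    exp (z d).\<close>
  define a b d :: complex where "a = - \<i> / of_real c" and "b = 1 / (of_real c)\<^sup>2" and "d = \<i> * of_real c"
  have abd: "a * d = 1" "a + b * d = 0"
    using c by (simp_all add: a_def b_def d_def power2_eq_square)
  have cis_d: "cis (c * x) = exp (of_real x * d)" for x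
    by (simp add: cis_conv_exp d_def mult_ac)
  have "((\<lambda>x. of_real x * cis (c * x)) has_integral
      ((of_real 1 * a + b) * exp (of_real 1 * d) - (of_real (-1) * a + b) * exp (of_real (-1) * d))) {-1..1}"
  proof (intro fundamental_theorem_of_calculus has_vector_derivative_real_field)
    fix x
    have "((\<lambda>z. (z * a + b) * exp (z * d)) has_field_derivative
        a * exp (of_real x * d) + (of_real x * a + b) * (exp (of_real x * d) * d)) (at (of_real x))"
      by (auto intro!: derivative_eq_intros)
    also have "a * exp (of_real x * d) + (of_real x * a + b) * (exp (of_real x * d) * d)
        = (a + b * d) * exp (of_real x * d) + (a * d) * (of_real x * exp (of_real x * d))"
      by (simp only: algebra_simps)
    finally show "((\<lambda>z. (z * a + b) * exp (z * d)) has_field_derivative of_real x * cis (c * x)) (at (of_real x))"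
      by (simp add: abd cis_d)
  qed auto
  also have "(of_real 1 * a + b) * exp (of_real 1 * d) - (of_real (-1) * a + b) * exp (of_real (-1) * d)
      = - 2 * \<i> * of_real (cos c / c)"
  proof -
    have "sin c = 0"
      by (simp add: c_def)
    then have "exp (of_real 1 * d) = of_real (cos c)" "exp (of_real (-1) * d) = of_real (cos c)"
      unfolding cis_d[symmetric] by (simp_all add: complex_eq_iff)
    then show ?thesis
      by (simp add: a_def algebra_simps)
  qed
  finally show ?thesis
    by (simp add: c_def)
qed

lemma sin_diff_of_int_pi: "sin (pi * (\<tau> - of_int k)) = sin (pi * \<tau>) * cos (pi * of_int k)"
  by (simp add: right_diff_distrib sin_diff)

text \<open>Writing \<tau> / k = 1 + (\<tau> - k) / k separates the Fourier coefficient of the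
  exponential from that of the linear correction.\<close>

lemma vt_coeff_alt:
  assumes "k \<noteq> 0"
  shows "vt_coeff \<tau> k = sinc (\<tau> - of_int k) + \<tau> * sinc \<tau> * (cos (pi * of_int k) / of_int k)"
proof -
  let ?c = "cos (pi * of_int k)"
  have s: "sinc (\<tau> - of_int k) * (\<tau> - of_int k) = sin (pi * \<tau>) * ?c / pi"
    using sin_diff_of_int_pi[of \<tau> k] by (auto simp: sinc_def)
  have t: "\<tau> * sinc \<tau> = sin (pi * \<tau>) / pi"
    by (auto simp: sinc_def)
  have "vt_coeff \<tau> k = sinc (\<tau> - of_int k) + sinc (\<tau> - of_int k) * (\<tau> - of_int k) / of_int k"
    using assms by (simp add: vt_coeff_def field_simps)
  then show ?thesis
    unfolding s t by simp
qed

text \<open>Multiplying the target by \<open>exp (- pi * \<i> * j * x)\<close> and integrating gives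
  \<^term>\<open>2 * vt_coeff \<tau> j\<close>; the linear term \<open>\<i> * pi * \<tau> * x\<close> makes the target 2-periodic.\<close>

lemma has_sum_vt_cis:
  assumes x: "x \<in> {-1..1}"
  shows "((\<lambda>k::int. of_real (vt_coeff \<tau> k) * cis (pi * of_int k * x)) has_sum
           (cis (pi * \<tau> * x) - of_real (sinc \<tau>) * (1 + \<i> * of_real (pi * \<tau> * x)))) (- {0})"
proof -
  define T where "T = (\<lambda>x. cis (pi * \<tau> * x) - of_real (sinc \<tau>) * (1 + \<i> * of_real (pi * \<tau> * x)))"
  define F where "F = (\<lambda>k x. of_real (vt_coeff \<tau> k) * cis (pi * of_int k * x))"
  define U where "U = (\<lambda>x. \<Sum>\<^sub>\<infinity>k\<in>- {0}. F k x)"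
  have nF: "norm (F k x) \<le> \<bar>vt_coeff \<tau> k\<bar>" for k x
    by (simp add: F_def norm_mult)
  \<comment> \<open>Uniform convergence from the M-test serves twice: it makes the sum
    \<open>U\<close> continuous and allows integration term by term.\<close>
  have lim: "uniform_limit {-1..1} (\<lambda>K x. \<Sum>k\<in>K. F k x) U (finite_subsets_at_top (- {0}))"
    unfolding U_def by (rule Weierstrass_m_test_general[OF nF summable_on_vt_coeff])
  have cF: "continuous_on {-1..1} (\<lambda>x. \<Sum>k\<in>K. F k x)" for K
    by (auto simp: F_def cis_conv_exp intro!: continuous_intros)
  have cU: "continuous_on {-1..1} U"
    using uniform_limit_theorem[OF _ lim] cF by simp
  have cT: "continuous_on {-1..1} T"
    by (auto simp: T_def cis_conv_exp intro!: continuous_intros)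
  \<comment> \<open>Pairing with frequency j, without conjugation, singles out the index k =
    -j.\<close>
  have int_F: "((\<lambda>x. F k x * cis (pi * of_int j * x)) has_integral (if k = -j then of_real (2 * vt_coeff \<tau> k) else 0)) {-1..1}" for k j
  proof -
    have "((\<lambda>x. of_real (vt_coeff \<tau> k) * cis (pi * of_int (k + j) * x)) has_integral 
        of_real (vt_coeff \<tau> k) * of_real (2 * sinc (of_int (k + j)))) {-1..1}"
      by (intro has_integral_mult_right has_integral_cis_int)
    moreover have "sinc (of_int (k + j)) = (if k = - j then 1 else 0)"
      using sin_npi_int[of "k + j"] by (auto simp: sinc_def add_eq_0_iff2 simp del: of_int_add)
    ultimately show ?thesis
      by (simp add: F_def mult.assoc cis_mult algebra_simps split: if_splits)
  qed
  have int_U: "((\<lambda>x. U x * cis (pi * of_int j * x)) has_integral (if j = 0 then 0 else of_real (2 * vt_coeff \<tau> (-j)))) {-1..1}" for j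
  proof -
    let ?G = "\<lambda>K x. (\<Sum>k\<in>K. F k x) * cis (pi * of_int j * x)"
    have "uniform_limit {-1..1} ?G (\<lambda>x. U x * cis (pi * of_int j * x)) (finite_subsets_at_top (- {0}))"
    proof (rule uniform_lim_mult[OF lim uniform_limit_const])
      show "bounded (U ` {-1..1})"
        by (intro compact_imp_bounded compact_continuous_image cU) auto
      show "bounded ((\<lambda>x. cis (pi * of_int j * x)) ` {-1..1})"
        by (auto simp: bounded_iff)
    qed
    then obtain I J where IJ: "\<And>K. (?G K has_integral I K) {-1..1}"
        "((\<lambda>x. U x * cis (pi * of_int j * x)) has_integral J) {-1..1}" "(I \<longlongrightarrow> J) (finite_subsets_at_top (- {0}))"
    proof (rule uniform_limit_integral)
      show "continuous_on {-1..1} (?G K)" for K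
        using cF[of K] by (auto simp: cis_conv_exp intro!: continuous_intros)
    qed auto
    have I: "I K = (\<Sum>k\<in>K. if k = -j then of_real (2 * vt_coeff \<tau> k) else 0)" if "finite K" for K
      using IJ(1)[of K] has_integral_sum[OF that int_F[of _ j]]
      by (auto simp: sum_distrib_right intro: has_integral_unique)
    have "\<forall>\<^sub>F K in finite_subsets_at_top (- {0}). I K = (if j = 0 then 0 else of_real (2 * vt_coeff \<tau> (-j)))"
      unfolding eventually_finite_subsets_at_top
      \<comment> \<open>Once K contains -j the integral no longer changes. For j = 0 that index is
        absent from the sum, so the starting set is empty and the value is 0.\<close>
      by (intro exI[of _ "{-j} - {0}"]) (auto simp: I sum.delta)
    then have "J = (if j = 0 then 0 else of_real (2 * vt_coeff \<tau> (-j)))"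
      by (intro tendsto_unique[OF _ IJ(3) tendsto_eventually]) simp_all
    with IJ(2) show ?thesis by simp
  qed
  have int_T: "((\<lambda>x. T x * cis (pi * of_int j * x)) has_integral (if j = 0 then 0 else of_real (2 * vt_coeff \<tau> (-j)))) {-1..1}" for j
  proof (cases "j = 0")
    case True
    \<comment> \<open>\<open>T\<close> has mean zero: the exponential has mean sinc \<tau>, which
      the constant cancels, and the linear term is odd.\<close>
    have "((\<lambda>x::real. cis (pi * \<tau> * x) - of_real (sinc \<tau>) * cis (pi * 0 * x)
            - \<i> * of_real (sinc \<tau> * pi * \<tau>) * of_real x) has_integral
          (of_real (2 * sinc \<tau>) - of_real (sinc \<tau>) * of_real (2 * sinc 0)
            - \<i> * of_real (sinc \<tau> * pi * \<tau>) * 0)) {-1..1}"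
      using has_integral_of_real[OF ident_has_integral[of "-1" "1::real"]]
      by (intro has_integral_diff has_integral_mult_right has_integral_cis_int) auto
    then show ?thesis
      using True by (simp add: T_def sinc_def algebra_simps)
  next
    case False
    then have mj: "- j \<noteq> 0" by simp
    have "((\<lambda>x. cis (pi * (\<tau> + of_int j) * x) - of_real (sinc \<tau>) * cis (pi * of_int j * x)
            - \<i> * of_real (sinc \<tau> * pi * \<tau>) * (of_real x * cis (pi * of_int j * x))) has_integral
          (of_real (2 * sinc (\<tau> + of_int j)) - of_real (sinc \<tau>) * of_real (2 * sinc (of_int j))
            - \<i> * of_real (sinc \<tau> * pi * \<tau>) * (- 2 * \<i> * of_real (cos (pi * of_int j) / (pi * of_int j))))) {-1..1}"
      by (intro has_integral_diff has_integral_mult_right has_integral_cis_int has_integral_id_cis_int False)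
    moreover have "T x * cis (pi * of_int j * x) = cis (pi * (\<tau> + of_int j) * x) - of_real (sinc \<tau>) * cis (pi * of_int j * x)
            - \<i> * of_real (sinc \<tau> * pi * \<tau>) * (of_real x * cis (pi * of_int j * x))" for x
      by (simp add: T_def cis_mult[symmetric] algebra_simps)
    moreover have "of_real (2 * sinc (\<tau> + of_int j)) - of_real (sinc \<tau>) * of_real (2 * sinc (of_int j))
            - \<i> * of_real (sinc \<tau> * pi * \<tau>) * (- 2 * \<i> * of_real (cos (pi * of_int j) / (pi * of_int j)))
        = complex_of_real (2 * vt_coeff \<tau> (-j))"
      using False vt_coeff_alt[OF mj, of \<tau>] sin_npi_int[of j]
      by (simp add: sinc_def complex_eq_iff)
    ultimately show ?thesis using False by simp
  qed
  have "exp_orthogonal (\<lambda>x. U x - T x)"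
    unfolding exp_orthogonal_def
  proof (intro conjI allI continuous_on_diff cU cT)
    show "((\<lambda>x. (U x - T x) * cis (pi * of_int k * x)) has_integral 0) {-1..1}" for k
      using has_integral_diff[OF int_U[of k] int_T[of k]] by (simp add: left_diff_distrib)
  qed
  \<comment> \<open>At both ends the imaginary part of \<open>T\<close> is sin (pi \<tau>) - pi
    \<tau> sinc \<tau> up to sign, hence 0, and the real parts agree by symmetry.\<close>
  moreover have "U (-1) - T (-1) = U 1 - T 1"
  proof -
    have "F k (-1) = F k 1" for k
      by (simp add: F_def complex_eq_iff)
    then have "U (-1) = U 1"
      by (simp add: U_def)
    moreover have "T (-1) = T 1"
      by (simp add: T_def complex_eq_iff sinc_def)
    ultimately show ?thesis by simp
  qed
  ultimately have "U x - T x = 0"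
    using exp_orthogonal_eq_0 x by blast
  moreover have "(\<lambda>k. F k x) summable_on - {0}"
    by (rule abs_summable_summable[OF summable_on_comparison_test[OF summable_on_vt_coeff]]) (use nF in auto)
  then have "((\<lambda>k. F k x) has_sum U x) (- {0})"
    unfolding U_def by (rule has_sum_infsum)
  ultimately show ?thesis
    by (simp add: F_def T_def)
qed

section \<open>The Hilbert space of a weighted graph\<close>

text \<open>Taking \<open>a = - s * cnj c\<close> turns the hypothesis into a real quadratic in \<open>s\<close>.\<close>

lemma cmod_sq_le_of_nonneg_quadratic:
  fixes c :: complex and p q :: real
  assumes nonneg: "\<And>a. 0 \<le> p + 2 * Re (a * c) + (cmod a)\<^sup>2 * q"
  shows "(cmod c)\<^sup>2 \<le> p * q"
proof -
  have *: "0 \<le> p - 2 * s * (cmod c)\<^sup>2 + s\<^sup>2 * (cmod c)\<^sup>2 * q" for s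
  proof -
    have "- of_real s * cnj c * c = of_real (- s * (cmod c)\<^sup>2)"
      using complex_norm_square[of c] by (simp add: mult_ac)
    then have "Re (- of_real s * cnj c * c) = - s * (cmod c)\<^sup>2"
      by (simp only: Re_complex_of_real)
    moreover have "(cmod (- of_real s * cnj c))\<^sup>2 = s\<^sup>2 * (cmod c)\<^sup>2"
      by (simp add: norm_mult power_mult_distrib)
    ultimately show ?thesis
      using nonneg[of "- of_real s * cnj c"] by simp
  qed
  consider "c = 0" | "c \<noteq> 0" "q \<le> 0" | "q > 0" by linarith
  then show ?thesis
  proof cases
    case 1
    have "p \<ge> 0" using nonneg[of 0] by simp
    have "q \<ge> 0"
    proof (rule ccontr)
      assume "\<not> q \<ge> 0"
      then have q: "q < 0" by simp
      \<comment> \<open>Chosen so that p + a^2 q = -1, which contradicts nonnegativity.\<close>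
      define a where "a = sqrt ((p + 1) / - q)"
      have "a\<^sup>2 * q = - (p + 1)"
        using q \<open>p \<ge> 0\<close> by (simp add: a_def field_simps)
      then show False
        using nonneg[of "of_real a"] 1 by simp
    qed
    then show ?thesis using 1 \<open>p \<ge> 0\<close> by simp
  next
    case 2
    \<comment> \<open>With q \<le> 0 the quadratic at this s is at most p - 2 (p + 1) < 0.\<close>
    define s where "s = (p + 1) / (cmod c)\<^sup>2"
    have s: "s * (cmod c)\<^sup>2 = p + 1"
      using 2 by (simp add: s_def)
    have "p \<ge> 0" using nonneg[of 0] by simp
    have "s\<^sup>2 * (cmod c)\<^sup>2 * q \<le> 0"
      using 2 by (intro mult_nonneg_nonpos) auto
    then have False
      using *[of s] s \<open>p \<ge> 0\<close> by (simp add: mult.assoc)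
    then show ?thesis ..
  next
    case 3
    \<comment> \<open>s = 1/q is the minimizer of the quadratic.\<close>
    have "0 \<le> p - 2 * (1/q) * (cmod c)\<^sup>2 + (1/q)\<^sup>2 * (cmod c)\<^sup>2 * q"
      by (rule *)
    also have "\<dots> = p - (cmod c)\<^sup>2 / q"
      using 3 by (simp add: power2_eq_square)
    finally show ?thesis
      using 3 by (simp add: field_simps)
  qed
qed

text \<open>Summability is not assumed: without it both infinite sums default to 0.\<close>

lemma infsum_complex_of_real: "(\<Sum>\<^sub>\<infinity>x\<in>A. complex_of_real (f x)) = of_real (\<Sum>\<^sub>\<infinity>x\<in>A. f x)"
proof (cases "f summable_on A")
  case True
  then show ?thesis
    by (intro infsumI has_sum_of_real has_sum_infsum)
next
  case False
  then have "\<not> (\<lambda>x. complex_of_real (f x)) summable_on A"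
    using summable_on_Re[of "\<lambda>x. complex_of_real (f x)" A] by auto
  with False show ?thesis
    by (simp add: infsum_not_exists)
qed

locale wgraph =
  fixes w :: "'v \<Rightarrow> 'v \<Rightarrow> real"
  assumes weighted: "weighted_graph w"
begin

lemma weight_nonneg: "0 \<le> w u v"
  and weight_sym: "w u v = w v u"
  and weight_summable: "w v summable_on UNIV"
  and vdeg_pos: "0 < vdeg w v"
  using weighted by (auto simp: weighted_graph_def)

lemma weight_le_vdeg: "w v u \<le> vdeg w u"
proof -
  have "w u v \<le> infsum (w u) UNIV"
    using finite_sum_le_infsum[OF weight_summable, of "{v}" u] weight_nonneg by simp
  then show ?thesis
    unfolding vdeg_def weight_sym[of v u] .
qed

lemma L2_inner_abs_summable:
  assumes "f \<in> L2 w" "g \<in> L2 w"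
  shows "(\<lambda>v. norm (f v * cnj (g v) * of_real (vdeg w v))) summable_on UNIV"
proof (rule summable_on_comparison_test)
  show "(\<lambda>v. (cmod (f v))\<^sup>2 * vdeg w v + (cmod (g v))\<^sup>2 * vdeg w v) summable_on UNIV"
    using assms by (intro summable_on_add) (auto simp: L2_def)
  fix v
  have "2 * (cmod (f v) * cmod (g v)) \<le> (cmod (f v))\<^sup>2 + (cmod (g v))\<^sup>2"
    using sum_squares_bound[of "cmod (f v)" "cmod (g v)"] by (simp add: mult.assoc)
  then have "cmod (f v) * cmod (g v) \<le> (cmod (f v))\<^sup>2 + (cmod (g v))\<^sup>2"
    by (smt (verit) mult_nonneg_nonneg norm_ge_zero)
  then show "norm (f v * cnj (g v) * of_real (vdeg w v)) \<le> (cmod (f v))\<^sup>2 * vdeg w v + (cmod (g v))\<^sup>2 * vdeg w v"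
    using vdeg_pos[of v] by (simp add: norm_mult flip: distrib_right)
qed auto

lemma L2_inner_summable:
  assumes "f \<in> L2 w" "g \<in> L2 w"
  shows "(\<lambda>v. f v * cnj (g v) * of_real (vdeg w v)) summable_on UNIV"
  using abs_summable_summable[OF L2_inner_abs_summable[OF assms]] .

lemma L2_scale: "f \<in> L2 w \<Longrightarrow> (\<lambda>v. a * f v) \<in> L2 w"
  unfolding L2_def using summable_on_cmult_right[of "\<lambda>v. (cmod (f v))\<^sup>2 * vdeg w v" UNIV "(cmod a)\<^sup>2"]
  by (simp add: norm_mult power_mult_distrib mult.assoc)

lemma L2_zero: "(\<lambda>v. 0) \<in> L2 w"
  by (simp add: L2_def)

lemma L2_add:
  assumes "f \<in> L2 w" "g \<in> L2 w" shows "(\<lambda>v. f v + g v) \<in> L2 w"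
proof -
  have "(\<lambda>v. (cmod (f v + g v))\<^sup>2 * vdeg w v) summable_on UNIV"
  proof (rule summable_on_comparison_test)
    show "(\<lambda>v. 2 * ((cmod (f v))\<^sup>2 * vdeg w v) + 2 * ((cmod (g v))\<^sup>2 * vdeg w v)) summable_on UNIV"
      using assms by (intro summable_on_add summable_on_cmult_right) (auto simp: L2_def)
    fix v
    have "(cmod (f v + g v))\<^sup>2 \<le> (cmod (f v) + cmod (g v))\<^sup>2"
      by (intro power_mono norm_triangle_ineq) auto
    also have "\<dots> \<le> 2 * (cmod (f v))\<^sup>2 + 2 * (cmod (g v))\<^sup>2"
      using sum_squares_bound[of "cmod (f v)" "cmod (g v)"] by (simp add: power2_sum)
    finally have "(cmod (f v + g v))\<^sup>2 * vdeg w v \<le> (2 * (cmod (f v))\<^sup>2 + 2 * (cmod (g v))\<^sup>2) * vdeg w v"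
      using vdeg_pos[of v] by (intro mult_right_mono) auto
    then show "(cmod (f v + g v))\<^sup>2 * vdeg w v \<le> 2 * ((cmod (f v))\<^sup>2 * vdeg w v) + 2 * ((cmod (g v))\<^sup>2 * vdeg w v)"
      by (simp add: algebra_simps)
  qed (use less_imp_le[OF vdeg_pos] in auto)
  then show ?thesis by (simp add: L2_def)
qed

lemma L2_diff: "f \<in> L2 w \<Longrightarrow> g \<in> L2 w \<Longrightarrow> (\<lambda>v. f v - g v) \<in> L2 w"
  using L2_add[of f "\<lambda>v. -1 * g v"] L2_scale[of g "-1"] by simp

lemma L2_sum: "(\<And>i. i \<in> I \<Longrightarrow> f i \<in> L2 w) \<Longrightarrow> (\<lambda>v. \<Sum>i\<in>I. f i v) \<in> L2 w"
  by (induction I rule: infinite_finite_induct) (auto intro: L2_add simp: L2_zero)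

lemma inner_add_left:
  assumes "f \<in> L2 w" "g \<in> L2 w" "h \<in> L2 w"
  shows "l2_inner w (\<lambda>v. f v + g v) h = l2_inner w f h + l2_inner w g h"
  using infsum_add[OF L2_inner_summable[OF assms(1,3)] L2_inner_summable[OF assms(2,3)]]
  by (simp add: l2_inner_def distrib_right)

lemma inner_scale_left: "l2_inner w (\<lambda>v. a * f v) h = a * l2_inner w f h"
  by (simp add: l2_inner_def mult.assoc infsum_cmult_right')

lemma inner_commute: "l2_inner w g f = cnj (l2_inner w f g)"
  unfolding l2_inner_def infsum_cnj[symmetric] by (simp add: mult_ac)

lemma inner_add_right:
  assumes "f \<in> L2 w" "g \<in> L2 w" "h \<in> L2 w"
  shows "l2_inner w h (\<lambda>v. f v + g v) = l2_inner w h f + l2_inner w h g"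
  using inner_add_left[OF assms] by (metis inner_commute complex_cnj_add)

lemma inner_scale_right: "l2_inner w h (\<lambda>v. a * f v) = cnj a * l2_inner w h f"
  using inner_scale_left by (metis inner_commute complex_cnj_mult)

lemma inner_diff_left:
  assumes "f \<in> L2 w" "g \<in> L2 w" "h \<in> L2 w"
  shows "l2_inner w (\<lambda>v. f v - g v) h = l2_inner w f h - l2_inner w g h"
  using inner_add_left[OF assms(1) L2_scale[OF assms(2), of "-1"] assms(3)] inner_scale_left[of "-1" g h]
  by simp

lemma inner_diff_right:
  assumes "f \<in> L2 w" "g \<in> L2 w" "h \<in> L2 w"
  shows "l2_inner w h (\<lambda>v. f v - g v) = l2_inner w h f - l2_inner w h g"
  using inner_diff_left[OF assms] by (metis inner_commute complex_cnj_diff)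

lemma inner_zero_left [simp]: "l2_inner w (\<lambda>v. 0) h = 0"
  and inner_zero_right [simp]: "l2_inner w h (\<lambda>v. 0) = 0"
  by (simp_all add: l2_inner_def)

lemma inner_sum_left:
  assumes "\<And>i. i \<in> I \<Longrightarrow> f i \<in> L2 w" "h \<in> L2 w"
  shows "l2_inner w (\<lambda>v. \<Sum>i\<in>I. f i v) h = (\<Sum>i\<in>I. l2_inner w (f i) h)"
  using assms
  by (induction I rule: infinite_finite_induct) (auto simp: inner_add_left L2_sum)

text \<open>Both equations hold for every f, because a divergent sum of squares gives 0 on each
  side.\<close>

lemma inner_self: "l2_inner w f f = of_real ((l2_norm w f)\<^sup>2)"
  and norm_sq_infsum: "(l2_norm w f)\<^sup>2 = (\<Sum>\<^sub>\<infinity>v. (cmod (f v))\<^sup>2 * vdeg w v)"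
proof -
  have "f v * cnj (f v) * of_real (vdeg w v) = of_real ((cmod (f v))\<^sup>2 * vdeg w v)" for v
    by (simp add: complex_mult_cnj cmod_power2)
  then have *: "l2_inner w f f = of_real (\<Sum>\<^sub>\<infinity>v. (cmod (f v))\<^sup>2 * vdeg w v)"
    by (simp only: l2_inner_def infsum_complex_of_real)
  moreover have "(\<Sum>\<^sub>\<infinity>v. (cmod (f v))\<^sup>2 * vdeg w v) \<ge> 0"
    using less_imp_le[OF vdeg_pos] by (intro infsum_nonneg) auto
  ultimately show "(l2_norm w f)\<^sup>2 = (\<Sum>\<^sub>\<infinity>v. (cmod (f v))\<^sup>2 * vdeg w v)"
    by (simp add: l2_norm_def)
  with * show "l2_inner w f f = of_real ((l2_norm w f)\<^sup>2)"
    by simp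
qed

lemma norm_nonneg [simp]: "0 \<le> l2_norm w f"
proof -
  have "0 \<le> Re (l2_inner w f f)"
    by (simp add: inner_self)
  then show ?thesis by (simp add: l2_norm_def)
qed

lemma norm_zero [simp]: "l2_norm w (\<lambda>v. 0) = 0"
  by (simp add: l2_norm_def)

lemma norm_add_sq:
  assumes "f \<in> L2 w" "g \<in> L2 w"
  shows "(l2_norm w (\<lambda>v. f v + g v))\<^sup>2 = (l2_norm w f)\<^sup>2 + 2 * Re (l2_inner w f g) + (l2_norm w g)\<^sup>2"
proof -
  have "of_real ((l2_norm w (\<lambda>v. f v + g v))\<^sup>2) = l2_inner w (\<lambda>v. f v + g v) (\<lambda>v. f v + g v)"
    by (rule inner_self[symmetric])
  also have "\<dots> = l2_inner w f f + l2_inner w f g + (l2_inner w g f + l2_inner w g g)"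
    using assms by (simp add: inner_add_left inner_add_right L2_add)
  also have "Re \<dots> = (l2_norm w f)\<^sup>2 + 2 * Re (l2_inner w f g) + (l2_norm w g)\<^sup>2"
    using inner_commute[of g f] by (simp add: inner_self)
  finally show ?thesis by simp
qed

lemma norm_scale: "l2_norm w (\<lambda>v. a * f v) = cmod a * l2_norm w f"
proof -
  have "of_real ((l2_norm w (\<lambda>v. a * f v))\<^sup>2) = l2_inner w (\<lambda>v. a * f v) (\<lambda>v. a * f v)"
    by (rule inner_self[symmetric])
  also have "\<dots> = a * cnj a * l2_inner w f f"
    by (simp add: inner_scale_left inner_scale_right)
  also have "\<dots> = of_real ((cmod a * l2_norm w f)\<^sup>2)"
    unfolding inner_self complex_norm_square[symmetric] by (simp add: power_mult_distrib)
  finally have "of_real ((l2_norm w (\<lambda>v. a * f v))\<^sup>2) = (of_real ((cmod a * l2_norm w f)\<^sup>2) :: complex)" .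
  then have "(l2_norm w (\<lambda>v. a * f v))\<^sup>2 = (cmod a * l2_norm w f)\<^sup>2"
    by (simp only: of_real_eq_iff)
  then show ?thesis by (simp add: power2_eq_iff_nonneg)
qed

lemma norm_minus_commute: "l2_norm w (\<lambda>v. f v - g v) = l2_norm w (\<lambda>v. g v - f v)"
  using norm_scale[of "-1" "\<lambda>v. f v - g v"] by simp

lemma Cauchy_Schwarz:
  assumes "f \<in> L2 w" "g \<in> L2 w"
  shows "cmod (l2_inner w f g) \<le> l2_norm w f * l2_norm w g"
proof -
  have "(cmod (l2_inner w f g))\<^sup>2 \<le> (l2_norm w f)\<^sup>2 * (l2_norm w g)\<^sup>2"
  proof (rule cmod_sq_le_of_nonneg_quadratic)
    fix a
    have "(l2_norm w (\<lambda>v. f v + cnj a * g v))\<^sup>2 \<ge> 0" by simp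
    then show "0 \<le> (l2_norm w f)\<^sup>2 + 2 * Re (a * l2_inner w f g) + (cmod a)\<^sup>2 * (l2_norm w g)\<^sup>2"
      using assms by (simp add: norm_add_sq L2_scale inner_scale_right norm_scale power_mult_distrib)
  qed
  then show ?thesis
    by (simp add: power2_le_iff_abs_le abs_mult flip: power_mult_distrib)
qed

lemma norm_triangle:
  assumes "f \<in> L2 w" "g \<in> L2 w"
  shows "l2_norm w (\<lambda>v. f v + g v) \<le> l2_norm w f + l2_norm w g"
proof (rule power2_le_imp_le)
  show "(l2_norm w (\<lambda>v. f v + g v))\<^sup>2 \<le> (l2_norm w f + l2_norm w g)\<^sup>2"
    using Cauchy_Schwarz[OF assms] complex_Re_le_cmod[of "l2_inner w f g"]
    by (simp add: norm_add_sq assms power2_sum)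
qed simp

lemma norm_diff_triangle:
  assumes "f \<in> L2 w" "g \<in> L2 w"
  shows "l2_norm w (\<lambda>v. f v - g v) \<le> l2_norm w f + l2_norm w g"
  using norm_triangle[OF assms(1) L2_scale[OF assms(2)], of "-1"] norm_scale[of "-1" g] by simp

text \<open>A single term of the sum that defines the squared norm. Positive degrees make point
  evaluation bounded, which turns norm approximation into approximation at a vertex.\<close>

lemma pointwise_le_norm:
  assumes "f \<in> L2 w"
  shows "cmod (f v) \<le> l2_norm w f / sqrt (vdeg w v)"
proof -
  have "(cmod (f v))\<^sup>2 * vdeg w v \<le> (l2_norm w f)\<^sup>2"
    unfolding norm_sq_infsum
    using finite_sum_le_infsum[of "\<lambda>v. (cmod (f v))\<^sup>2 * vdeg w v" UNIV "{v}"] assms vdeg_pos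
    by (auto simp: L2_def less_imp_le)
  then have "sqrt ((cmod (f v))\<^sup>2 * vdeg w v) \<le> l2_norm w f"
    by (simp add: real_le_lsqrt)
  then show ?thesis
    using vdeg_pos[of v] by (simp add: real_sqrt_mult field_simps)
qed

lemma norm_eq_0D:
  assumes "f \<in> L2 w" "l2_norm w f = 0" shows "f = (\<lambda>v. 0)"
  using pointwise_le_norm[OF assms(1)] assms(2) by (auto simp: fun_eq_iff)

text \<open>By symmetry w v u is at most the degree of u, so |f u| \<le> |f u|^2 + 1 bounds the
  terms f u * w v u by a summable family. The series for \<Delta> f thus converges for every
  square-summable f, inside the operator domain or not, and linearity follows.\<close>

lemma laplace_summable:
  assumes "f \<in> L2 w"
  shows "(\<lambda>u. (f v - f u) * of_real (w v u)) summable_on UNIV"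
proof -
  have "(\<lambda>u. norm (f u * of_real (w v u))) summable_on UNIV"
  proof (rule summable_on_comparison_test)
    show "(\<lambda>u. (cmod (f u))\<^sup>2 * vdeg w u + w v u) summable_on UNIV"
      using assms by (intro summable_on_add weight_summable) (auto simp: L2_def)
    fix u
    have "cmod (f u) \<le> (cmod (f u))\<^sup>2 + 1"
      using sum_squares_bound[of "cmod (f u)" 1] norm_ge_zero[of "f u"] by (simp del: norm_ge_zero)
    then have "cmod (f u) * w v u \<le> ((cmod (f u))\<^sup>2 + 1) * w v u"
      using weight_nonneg by (intro mult_right_mono)
    also have "\<dots> = (cmod (f u))\<^sup>2 * w v u + w v u"
      by (simp add: distrib_right)
    also have "\<dots> \<le> (cmod (f u))\<^sup>2 * vdeg w u + w v u"
      by (intro add_right_mono mult_left_mono weight_le_vdeg) auto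
    finally show "norm (f u * of_real (w v u)) \<le> (cmod (f u))\<^sup>2 * vdeg w u + w v u"
      by (simp add: norm_mult weight_nonneg)
  qed auto
  then have "(\<lambda>u. f u * of_real (w v u)) summable_on UNIV"
    by (rule abs_summable_summable)
  moreover have "(\<lambda>u. f v * of_real (w v u)) summable_on UNIV"
    by (intro summable_on_cmult_right summable_on_of_real weight_summable)
  ultimately show ?thesis
    using summable_on_add[of "\<lambda>u. f v * of_real (w v u)" UNIV "\<lambda>u. - (f u * of_real (w v u))"]
    by (simp add: left_diff_distrib summable_on_uminus)
qed

lemma laplace_add:
  assumes "f \<in> L2 w" "g \<in> L2 w"
  shows "laplace w (\<lambda>v. f v + g v) = (\<lambda>v. laplace w f v + laplace w g v)"
  using infsum_add[OF laplace_summable[OF assms(1)] laplace_summable[OF assms(2)]]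
  by (simp add: laplace_def fun_eq_iff algebra_simps)

lemma laplace_scale: "laplace w (\<lambda>v. a * f v) = (\<lambda>v. a * laplace w f v)"
  unfolding laplace_def infsum_cmult_right'[symmetric] by (simp add: algebra_simps)

lemma laplace_diff:
  assumes "f \<in> L2 w" "g \<in> L2 w"
  shows "laplace w (\<lambda>v. f v - g v) = (\<lambda>v. laplace w f v - laplace w g v)"
  using laplace_add[OF assms(1) L2_scale[OF assms(2), of "-1"]] laplace_scale[of "-1" g] by simp

end

section \<open>Spectral resolution of the Laplacian\<close>

text \<open>The resolution is a parameter so that the theory can be interpreted a second time, in
  \<open>PW_iff\<close>, for the resolution that witnesses membership in \<open>PW\<close>.\<close>

locale laplace_spectral = wgraph +
  fixes D :: "('v \<Rightarrow> complex) set" and E :: "real set \<Rightarrow> ('v \<Rightarrow> complex) \<Rightarrow> 'v \<Rightarrow> complex"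
  assumes domain: "laplace_domain w D"
    and resolution: "spectral_resolution w D (laplace w) E"
begin

abbreviation L where "L \<equiv> laplace w"
abbreviation M where "M \<equiv> spectral_measure w E"

lemma D_L2: "f \<in> D \<Longrightarrow> f \<in> L2 w"
  and D_add: "f \<in> D \<Longrightarrow> g \<in> D \<Longrightarrow> (\<lambda>v. f v + g v) \<in> D"
  and D_scale: "f \<in> D \<Longrightarrow> (\<lambda>v. a * f v) \<in> D"
  and D_dense: "f \<in> L2 w \<Longrightarrow> e > 0 \<Longrightarrow> \<exists>g\<in>D. l2_norm w (\<lambda>v. f v - g v) < e"
  and L_L2: "f \<in> D \<Longrightarrow> L f \<in> L2 w"
  and L_sym: "f \<in> D \<Longrightarrow> g \<in> D \<Longrightarrow> l2_inner w (L f) g = l2_inner w f (L g)"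
  and L_nonneg: "f \<in> D \<Longrightarrow> 0 \<le> Re (l2_inner w (L f) f)"
  using domain by (auto simp: laplace_domain_def selfadjoint_def l2_dense_subspace_def)

lemma D_diff: "f \<in> D \<Longrightarrow> g \<in> D \<Longrightarrow> (\<lambda>v. f v - g v) \<in> D"
  using D_add[of f "\<lambda>v. -1 * g v"] D_scale[of g "-1"] by simp

text \<open>The difference f - g is orthogonal to D, and D contains vectors arbitrarily close to f -
  g.\<close>

lemma eq_if_inner_D:
  assumes fg: "f \<in> L2 w" "g \<in> L2 w" and eq: "\<And>h. h \<in> D \<Longrightarrow> l2_inner w f h = l2_inner w g h"
  shows "f = g"
proof -
  let ?x = "\<lambda>v. f v - g v"
  have x: "?x \<in> L2 w" using fg by (rule L2_diff)
  have "l2_norm w ?x \<le> e" if e: "e > 0" for e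
  proof -
    obtain h where h: "h \<in> D" "l2_norm w (\<lambda>v. ?x v - h v) < e"
      using D_dense[OF x e] by blast
    have "l2_inner w ?x h = 0"
      using eq[OF h(1)] fg D_L2[OF h(1)] by (simp add: inner_diff_left)
    then have "l2_inner w ?x ?x = l2_inner w ?x (\<lambda>v. ?x v - h v)"
      using inner_diff_right[OF x D_L2[OF h(1)] x] by simp
    then have "(l2_norm w ?x)\<^sup>2 = cmod (l2_inner w ?x (\<lambda>v. ?x v - h v))"
      by (metis inner_self norm_of_real abs_power2)
    also have "\<dots> \<le> l2_norm w ?x * l2_norm w (\<lambda>v. ?x v - h v)"
      by (intro Cauchy_Schwarz x L2_diff D_L2 h)
    also have "\<dots> \<le> l2_norm w ?x * e"
      using h(2) by (intro mult_left_mono) auto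
    finally show ?thesis
      using e norm_nonneg[of ?x] by (cases "l2_norm w ?x = 0") (auto simp: power2_eq_square)
  qed
  then have "l2_norm w ?x = 0"
    using norm_nonneg[of ?x] field_le_epsilon[of "l2_norm w ?x" 0] by (simp add: antisym)
  from norm_eq_0D[OF x this] show ?thesis
    by (auto simp: fun_eq_iff)
qed

section \<open>Calculus of the spectral projections\<close>

lemma pvm: "projection_valued_measure w E"
  using resolution by (simp add: spectral_resolution_def)

lemma E_projection: "B \<in> sets borel \<Longrightarrow> orthogonal_projection w (E B)"
  using pvm by (simp add: projection_valued_measure_def)

lemma E_L2: "B \<in> sets borel \<Longrightarrow> f \<in> L2 w \<Longrightarrow> E B f \<in> L2 w"
  and E_idem: "B \<in> sets borel \<Longrightarrow> f \<in> L2 w \<Longrightarrow> E B (E B f) = E B f"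
  and E_add: "B \<in> sets borel \<Longrightarrow> f \<in> L2 w \<Longrightarrow> g \<in> L2 w \<Longrightarrow> E B (\<lambda>v. f v + g v) = (\<lambda>v. E B f v + E B g v)"
  and E_scale: "B \<in> sets borel \<Longrightarrow> f \<in> L2 w \<Longrightarrow> E B (\<lambda>v. a * f v) = (\<lambda>v. a * E B f v)"
  and E_sym: "B \<in> sets borel \<Longrightarrow> f \<in> L2 w \<Longrightarrow> g \<in> L2 w \<Longrightarrow> l2_inner w (E B f) g = l2_inner w f (E B g)"
  using E_projection[of B] by (simp_all add: orthogonal_projection_def)

lemma E_diff:
  "B \<in> sets borel \<Longrightarrow> f \<in> L2 w \<Longrightarrow> g \<in> L2 w \<Longrightarrow> E B (\<lambda>v. f v - g v) = (\<lambda>v. E B f v - E B g v)"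
  using E_add[of B f "\<lambda>v. -1 * g v"] E_scale[of B g "-1"] L2_scale[of g "-1"] by simp

lemma E_zero: "B \<in> sets borel \<Longrightarrow> E B (\<lambda>v. 0) = (\<lambda>v. 0)"
  using E_scale[of B "\<lambda>v. 0" 0] L2_zero by simp

lemma E_UNIV: "f \<in> L2 w \<Longrightarrow> E UNIV f = f"
  and E_Int: "A \<in> sets borel \<Longrightarrow> B \<in> sets borel \<Longrightarrow> f \<in> L2 w \<Longrightarrow> E A (E B f) = E (A \<inter> B) f"
  and E_countable: "range F \<subseteq> sets borel \<Longrightarrow> disjoint_family F \<Longrightarrow> f \<in> L2 w \<Longrightarrow>
     (\<lambda>n. l2_norm w (\<lambda>v. E (\<Union>i::nat. F i) f v - (\<Sum>i<n. E (F i) f v))) \<longlonglongrightarrow> 0"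
  using pvm by (auto simp: projection_valued_measure_def)

lemma E_norm: "B \<in> sets borel \<Longrightarrow> f \<in> L2 w \<Longrightarrow> l2_inner w (E B f) f = of_real ((l2_norm w (E B f))\<^sup>2)"
  using E_sym[of B "E B f" f] by (simp add: E_L2 E_idem inner_self)

lemma E_norm_le:
  assumes "B \<in> sets borel" "f \<in> L2 w" shows "l2_norm w (E B f) \<le> l2_norm w f"
proof -
  have "(l2_norm w (E B f))\<^sup>2 \<le> l2_norm w (E B f) * l2_norm w f"
    using Cauchy_Schwarz[OF E_L2[OF assms] assms(2)] by (simp add: E_norm assms norm_power)
  then show ?thesis
    using norm_nonneg[of "E B f"] norm_nonneg[of f]
    by (cases "l2_norm w (E B f) = 0") (auto simp: power2_eq_square)
qed

text \<open>Countable additivity for the constantly empty family has n-th defect |1 - n| times the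
  norm of \<open>E {} f\<close>; this can tend to 0 only if the norm is 0.\<close>

lemma E_empty:
  assumes f: "f \<in> L2 w" shows "E {} f = (\<lambda>v. 0)"
proof -
  have 0: "(\<lambda>n. l2_norm w (\<lambda>v. E {} f v - (\<Sum>i<n. E {} f v))) \<longlonglongrightarrow> 0"
    using E_countable[of "\<lambda>i. {}" f] f by (simp add: disjoint_family_on_def)
  have "l2_norm w (\<lambda>v. E {} f v - (\<Sum>i<n. E {} f v)) = \<bar>1 - real n\<bar> * l2_norm w (E {} f)" for n
  proof -
    have "(\<lambda>v. E {} f v - (\<Sum>i<n. E {} f v)) = (\<lambda>v. of_real (1 - real n) * E {} f v)"
      by (simp add: algebra_simps)
    then show ?thesis
      by (simp only: norm_scale norm_of_real)
  qed
  with 0 have lim: "(\<lambda>n. \<bar>1 - real n\<bar> * l2_norm w (E {} f)) \<longlonglongrightarrow> 0"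
    by simp
  have "\<forall>\<^sub>F n in sequentially. l2_norm w (E {} f) \<le> \<bar>1 - real n\<bar> * l2_norm w (E {} f)"
    unfolding eventually_sequentially
  proof (intro exI[of _ 2] allI impI)
    fix n :: nat assume "2 \<le> n"
    then have "1 \<le> \<bar>1 - real n\<bar>" by simp
    from mult_right_mono[OF this norm_nonneg] show "l2_norm w (E {} f) \<le> \<bar>1 - real n\<bar> * l2_norm w (E {} f)"
      by simp
  qed
  then have "l2_norm w (E {} f) \<le> 0"
    using tendsto_lowerbound[OF lim] by simp
  then show ?thesis
    using norm_nonneg[of "E {} f"] by (intro norm_eq_0D) (simp_all add: E_L2 f)
qed

lemma E_range_disjoint:
  assumes "A \<in> sets borel" "B \<in> sets borel" "f \<in> L2 w" "A \<inter> B = {}" "E B f = f"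
  shows "E A f = (\<lambda>v. 0)"
  using E_Int[OF assms(1,2,3)] assms by (simp add: E_empty)

lemma E_range_subset:
  assumes "A \<in> sets borel" "B \<in> sets borel" "f \<in> L2 w" "B \<subseteq> A" "E B f = f"
  shows "E A f = f"
  using E_Int[OF assms(1,2,3)] assms by (simp add: Int_absorb1)

text \<open>Pairing the norm-convergent defect with f yields scalar additivity, because
  \<open>l2_inner w (E B f) f\<close> is the squared norm of \<open>E B f\<close>.\<close>

lemma E_sums:
  assumes F: "range F \<subseteq> sets borel" "disjoint_family F" and f: "f \<in> L2 w"
  shows "(\<lambda>i. (l2_norm w (E (F i) f))\<^sup>2) sums (l2_norm w (E (\<Union>i::nat. F i) f))\<^sup>2"
proof -
  have F': "F i \<in> sets borel" for i using F by auto
  have U: "(\<Union>i. F i) \<in> sets borel" using F by auto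
  have "(\<lambda>n. (\<Sum>i<n. (l2_norm w (E (F i) f))\<^sup>2) - (l2_norm w (E (\<Union>i. F i) f))\<^sup>2) \<longlonglongrightarrow> 0"
  proof (rule Lim_null_comparison)
    show "(\<lambda>n. l2_norm w (\<lambda>v. E (\<Union>i. F i) f v - (\<Sum>i<n. E (F i) f v)) * l2_norm w f) \<longlonglongrightarrow> 0"
      using tendsto_mult_left_zero[OF E_countable[OF F f]] .
    have "norm ((\<Sum>i<n. (l2_norm w (E (F i) f))\<^sup>2) - (l2_norm w (E (\<Union>i. F i) f))\<^sup>2)
        \<le> l2_norm w (\<lambda>v. E (\<Union>i. F i) f v - (\<Sum>i<n. E (F i) f v)) * l2_norm w f" for n
    proof -
      have "l2_inner w (\<lambda>v. E (\<Union>i. F i) f v - (\<Sum>i<n. E (F i) f v)) f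
          = of_real ((l2_norm w (E (\<Union>i. F i) f))\<^sup>2 - (\<Sum>i<n. (l2_norm w (E (F i) f))\<^sup>2))"
        by (simp add: inner_diff_left inner_sum_left E_norm E_L2 L2_sum F' U f)
      moreover have "cmod (l2_inner w (\<lambda>v. E (\<Union>i. F i) f v - (\<Sum>i<n. E (F i) f v)) f)
          \<le> l2_norm w (\<lambda>v. E (\<Union>i. F i) f v - (\<Sum>i<n. E (F i) f v)) * l2_norm w f"
        by (intro Cauchy_Schwarz L2_diff L2_sum E_L2 F' U f)
      ultimately show ?thesis
        by (simp only: norm_of_real real_norm_def abs_minus_commute)
    qed
    then show "\<forall>\<^sub>F n in sequentially. norm ((\<Sum>i<n. (l2_norm w (E (F i) f))\<^sup>2) - (l2_norm w (E (\<Union>i. F i) f))\<^sup>2)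
        \<le> l2_norm w (\<lambda>v. E (\<Union>i. F i) f v - (\<Sum>i<n. E (F i) f v)) * l2_norm w f"
      by simp
  qed
  then show ?thesis
    unfolding sums_def using LIM_zero_iff by blast
qed

section \<open>Scalar spectral measures and the quadratic form\<close>

lemma sets_M [simp, measurable_cong]: "sets (M f) = sets borel"
  and space_M [simp]: "space (M f) = UNIV"
  using sets.sigma_sets_eq[of "borel :: real measure"] by (simp_all add: spectral_measure_def)

text \<open>\<open>measure_of\<close> returns the prescribed set function only if that function is a
  measure and is zero otherwise, so countable additivity has to be established for each
  square-summable f.\<close>

lemma emeasure_M:
  assumes "B \<in> sets borel" "f \<in> L2 w"
  shows "emeasure (M f) B = ennreal ((l2_norm w (E B f))\<^sup>2)"
proof -
  have form: "Re (l2_inner w (E B f) f) = (l2_norm w (E B f))\<^sup>2" if "B \<in> sets borel" for B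
    using E_norm[OF that assms(2)] by simp
  have "emeasure (M f) B = ennreal (Re (l2_inner w (E B f) f))"
    unfolding spectral_measure_def
  proof (rule emeasure_measure_of_sigma)
    show "sigma_algebra UNIV (sets (borel :: real measure))"
      using sets.sigma_algebra_axioms[of "borel :: real measure"] by simp
    show "positive (sets borel) (\<lambda>B. ennreal (Re (l2_inner w (E B f) f)))"
      using assms(2) by (simp add: positive_def E_empty)
    show "countably_additive (sets borel) (\<lambda>B. ennreal (Re (l2_inner w (E B f) f)))"
    proof (rule countably_additiveI)
      fix F :: "nat \<Rightarrow> real set"
      assume F: "range F \<subseteq> sets borel" "disjoint_family F" "(\<Union>i. F i) \<in> sets borel"
      have F': "F i \<in> sets borel" for i using F by auto
      note s = E_sums[OF F(1,2) assms(2)]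
      have "(\<Sum>i. ennreal ((l2_norm w (E (F i) f))\<^sup>2)) = ennreal ((l2_norm w (E (\<Union>i. F i) f))\<^sup>2)"
        unfolding sums_unique[OF s] by (rule suminf_ennreal2[OF _ sums_summable[OF s]]) simp
      then show "(\<Sum>i. ennreal (Re (l2_inner w (E (F i) f) f))) = ennreal (Re (l2_inner w (E (\<Union>i. F i) f) f))"
        unfolding form[OF F'] form[OF F(3)] .
    qed
  qed (use assms in auto)
  then show ?thesis
    using assms by (simp add: E_norm)
qed

lemma finite_M: "f \<in> L2 w \<Longrightarrow> finite_measure (M f)"
  by (rule finite_measureI) (simp add: emeasure_M)

lemma M_eqI:
  assumes "f \<in> L2 w" "g \<in> L2 w" "\<And>B. B \<in> sets borel \<Longrightarrow> l2_norm w (E B f) = l2_norm w (E B g)"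
  shows "M f = M g"
  by (rule measure_eqI) (simp_all add: emeasure_M assms)

lemma M_E:
  assumes B: "B \<in> sets borel" and f: "f \<in> L2 w"
  shows "M (E B f) = density (M f) (indicator B)"
proof (rule measure_eqI)
  fix A assume A: "A \<in> sets (M (E B f))"
  have "emeasure (density (M f) (indicator B)) A = emeasure (M f) (A \<inter> B)"
    using A B by (subst emeasure_density) (auto simp: indicator_inter_arith[symmetric] mult.commute)
  then show "emeasure (M (E B f)) A = emeasure (density (M f) (indicator B)) A"
    using A B f by (simp add: emeasure_M E_L2 E_Int)
qed simp

lemma AE_M:
  assumes "B \<in> sets borel" "f \<in> L2 w" "E B f = f"
  shows "AE x in M f. x \<in> B"
proof (rule AE_I')
  have "E (- B) f = (\<lambda>v. 0)"
    using assms by (intro E_range_disjoint[of "- B" B]) auto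
  then show "- B \<in> null_sets (M f)"
    using assms by (auto simp: null_sets_def emeasure_M)
qed auto

lemma D_iff: "f \<in> D \<longleftrightarrow> f \<in> L2 w \<and> (\<integral>\<^sup>+x. ennreal (x\<^sup>2) \<partial>M f) < \<infinity>"
  using resolution unfolding spectral_resolution_def by blast

lemma L_form: "f \<in> D \<Longrightarrow> l2_inner w (L f) f = of_real (\<integral>x. x \<partial>M f)"
  using resolution unfolding spectral_resolution_def by blast

lemma E_D:
  assumes B: "B \<in> sets borel" and f: "f \<in> D"
  shows "E B f \<in> D"
proof -
  have "(\<integral>\<^sup>+x. ennreal (x\<^sup>2) \<partial>M (E B f)) = (\<integral>\<^sup>+x. indicator B x * ennreal (x\<^sup>2) \<partial>M f)"
    using B f by (simp add: M_E D_L2 nn_integral_density)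
  also have "\<dots> \<le> (\<integral>\<^sup>+x. ennreal (x\<^sup>2) \<partial>M f)"
    by (intro nn_integral_mono) (auto simp: indicator_def)
  finally show ?thesis
    using f B by (auto simp: D_iff E_L2)
qed

lemma bounded_range_D:
  assumes B: "B \<in> sets borel" "B \<subseteq> {a..b}" and f: "f \<in> L2 w" "E B f = f"
  shows "f \<in> D"
proof -
  have sq: "x\<^sup>2 \<le> (max \<bar>a\<bar> \<bar>b\<bar>)\<^sup>2" if "x \<in> B" for x
  proof -
    have "a \<le> x" "x \<le> b" using that B(2) by auto
    then show ?thesis by (intro power2_le_iff_abs_le[THEN iffD2]) auto
  qed
  have "(\<integral>\<^sup>+x. ennreal (x\<^sup>2) \<partial>M f) \<le> (\<integral>\<^sup>+x. ennreal ((max \<bar>a\<bar> \<bar>b\<bar>)\<^sup>2) \<partial>M f)"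
    using AE_M[OF B(1) f] sq by (intro nn_integral_mono_AE) (auto intro!: ennreal_leI elim!: eventually_mono)
  also have "\<dots> < \<infinity>"
    using f by (simp add: emeasure_M ennreal_mult_less_top)
  finally show ?thesis
    using f by (simp add: D_iff)
qed

lemma integrable_M:
  assumes f: "f \<in> D" shows "integrable (M f) (\<lambda>x. x)"
proof (rule Bochner_Integration.integrable_bound)
  interpret finite_measure "M f"
    using finite_M D_L2[OF f] .
  have "integrable (M f) (\<lambda>x. x\<^sup>2)"
    using f by (simp add: D_iff integrable_iff_bounded)
  then show "integrable (M f) (\<lambda>x. x\<^sup>2 + 1)"
    by simp
  have "\<bar>x\<bar> \<le> x\<^sup>2 + 1" for x :: real
    using sum_squares_bound[of "\<bar>x\<bar>" 1] by simp
  then show "AE x in M f. norm x \<le> norm (x\<^sup>2 + 1)"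
    by simp
qed simp

lemma L_form_ge:
  assumes B: "B \<in> sets borel" "B \<subseteq> {a..}" and f: "f \<in> D" "E B f = f"
  shows "a * (l2_norm w f)\<^sup>2 \<le> Re (l2_inner w (L f) f)"
proof -
  interpret finite_measure "M f"
    using finite_M D_L2[OF f(1)] .
  have "AE x in M f. a \<le> x"
    using AE_M[OF B(1) D_L2[OF f(1)] f(2)] B(2) by (auto elim!: eventually_mono)
  then have "(\<integral>x. a \<partial>M f) \<le> (\<integral>x. x \<partial>M f)"
    using integrable_M[OF f(1)] by (intro integral_mono_AE) auto
  moreover have "measure (M f) UNIV = (l2_norm w f)\<^sup>2"
    using D_L2[OF f(1)] by (simp add: measure_def emeasure_M E_UNIV)
  ultimately show ?thesis
    by (simp add: L_form f mult.commute)
qed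

lemma L_form_le:
  assumes B: "B \<in> sets borel" "B \<subseteq> {..b}" and f: "f \<in> D" "E B f = f"
  shows "Re (l2_inner w (L f) f) \<le> b * (l2_norm w f)\<^sup>2"
proof -
  interpret finite_measure "M f"
    using finite_M D_L2[OF f(1)] .
  have "AE x in M f. x \<le> b"
    using AE_M[OF B(1) D_L2[OF f(1)] f(2)] B(2) by (auto elim!: eventually_mono)
  then have "(\<integral>x. x \<partial>M f) \<le> (\<integral>x. b \<partial>M f)"
    using integrable_M[OF f(1)] by (intro integral_mono_AE) auto
  moreover have "measure (M f) UNIV = (l2_norm w f)\<^sup>2"
    using D_L2[OF f(1)] by (simp add: measure_def emeasure_M E_UNIV)
  ultimately show ?thesis
    by (simp add: L_form f mult.commute)
qed

section \<open>Compatibility of the Laplacian with spectral projections\<close>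

text \<open>The spectral measure of \<open>u + a * h\<close> is the same for every unimodular \<open>a\<close>, hence so is the
  quadratic form of the operator; polarization kills the cross term.\<close>

lemma L_orthogonal:
  assumes B: "B \<in> sets borel" and u: "u \<in> D" "E B u = u" and h: "h \<in> D" "E B h = (\<lambda>v. 0)"
  shows "l2_inner w (L u) h = 0"
proof -
  note [simp] = u(1) h(1) D_L2 L_L2 D_scale D_add L2_scale L2_add E_L2
  \<comment> \<open>\<open>E C u\<close> stays in the range of \<open>E B\<close>, so a factor
    \<open>E B\<close> can be moved onto h, which it annihilates.\<close>
  have cross: "l2_inner w (E C u) (E C h) = 0" if C: "C \<in> sets borel" for C
  proof -
    have "l2_inner w (E C u) (E C h) = l2_inner w (E C (E C u)) h"
      using E_sym[OF C, of "E C u" h] C by simp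
    also have "E C (E C u) = E B (E C u)"
      using B C u by (simp add: E_Int E_idem Int_commute)  (metis E_Int Int_commute D_L2 u)
    also have "l2_inner w (E B (E C u)) h = l2_inner w (E C u) (E B h)"
      using B C by (intro E_sym) simp_all
    finally show ?thesis
      by (simp add: h)
  qed
  have nrm: "(l2_norm w (E C (\<lambda>v. u v + a * h v)))\<^sup>2 = (l2_norm w (E C u))\<^sup>2 + (l2_norm w (E C h))\<^sup>2"
    if "C \<in> sets borel" "cmod a = 1" for C a
    using that by (simp add: E_add E_scale norm_add_sq inner_scale_right cross norm_scale)
  have M: "M (\<lambda>v. u v + a * h v) = M (\<lambda>v. u v + 1 * h v)" if "cmod a = 1" for a
  proof (rule M_eqI)
    fix C :: "real set" assume C: "C \<in> sets borel"
    show "l2_norm w (E C (\<lambda>v. u v + a * h v)) = l2_norm w (E C (\<lambda>v. u v + 1 * h v))"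
      using nrm[OF C that] nrm[OF C, of 1] by (simp add: power2_eq_iff_nonneg[OF norm_nonneg norm_nonneg, symmetric])
  qed simp_all
  define q where "q a = l2_inner w (L (\<lambda>v. u v + a * h v)) (\<lambda>v. u v + a * h v)" for a
  have q1: "q a = q 1" if "cmod a = 1" for a
    using M[OF that] by (simp add: q_def L_form)
  have q: "q a = l2_inner w (L u) u + cnj a * l2_inner w (L u) h + a * l2_inner w (L h) u + a * cnj a * l2_inner w (L h) h" for a
    by (simp add: q_def laplace_add laplace_scale inner_add_left inner_add_right inner_scale_left inner_scale_right algebra_simps)
  \<comment> \<open>Let p and r be the cross terms with factors cnj a and a. The value a = -1 gives
    p + r = 0, and a = i gives -i p + i r = p + r = 0; hence p = r = 0.\<close>
  show ?thesis
    using q1[of "-1"] q1[of \<i>] by (simp add: q) (simp add: complex_eq_iff)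
qed

text \<open>The identity is tested on h in D. By \<open>L_orthogonal\<close> the vector L (E B f)
  pairs with h only through E B h, and L f differs from it by something orthogonal to E B h.\<close>

lemma L_E:
  assumes B: "B \<in> sets borel" and f: "f \<in> D"
  shows "L (E B f) = E B (L f)"
proof (rule eq_if_inner_D)
  note [simp] = f B D_L2 L_L2 D_diff E_L2 E_D
  show "L (E B f) \<in> L2 w" "E B (L f) \<in> L2 w" by simp_all
  fix h assume h [simp]: "h \<in> D"
  have kill: "E B (\<lambda>v. x v - E B x v) = (\<lambda>v. 0)" if "x \<in> D" for x
    using that by (simp add: E_diff E_idem)
  have "l2_inner w (L (E B f)) h - l2_inner w (L (E B f)) (E B h) = l2_inner w (L (E B f)) (\<lambda>v. h v - E B h v)"
    by (simp add: inner_diff_right)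
  also have "\<dots> = 0"
    by (rule L_orthogonal[OF B]) (simp_all add: E_idem kill)
  finally have 1: "l2_inner w (L (E B f)) h = l2_inner w (L (E B f)) (E B h)"
    by simp
  have "l2_inner w (L f) (E B h) - l2_inner w (L (E B f)) (E B h) = l2_inner w (L (\<lambda>v. f v - E B f v)) (E B h)"
    by (simp add: laplace_diff inner_diff_left)
  also have "\<dots> = cnj (l2_inner w (L (E B h)) (\<lambda>v. f v - E B f v))"
    by (subst L_sym) (simp_all flip: inner_commute)
  also have "l2_inner w (L (E B h)) (\<lambda>v. f v - E B f v) = 0"
    by (rule L_orthogonal[OF B]) (simp_all add: E_idem kill)
  finally have "l2_inner w (L f) (E B h) = l2_inner w (L (E B f)) (E B h)"
    by simp
  with 1 show "l2_inner w (L (E B f)) h = l2_inner w (E B (L f)) h"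
    by (simp add: E_sym)
qed

lemma L_range:
  assumes "B \<in> sets borel" "f \<in> D" "E B f = f" shows "E B (L f) = L f"
  using L_E[OF assms(1,2)] assms(3) by simp

text \<open>On the range of \<open>E B\<close> the form of \<open>\<Delta> - a\<close> is nonnegative and at most \<open>b - a\<close>, so
  Cauchy-Schwarz for this form, applied to \<open>f\<close> and \<open>\<Delta> f - a * f\<close>, bounds the operator.\<close>

lemma L_shift_norm_le:
  assumes B: "B \<in> sets borel" "B \<subseteq> {a..b}" and f: "f \<in> L2 w" "E B f = f"
  shows "l2_norm w (\<lambda>v. L f v - of_real a * f v) \<le> (b - a) * l2_norm w f"
proof (cases "f = (\<lambda>v. 0)")
  case True
  then show ?thesis by (simp add: laplace_def)
next
  case False
  define A where "A u = (\<lambda>v. L u v - of_real a * u v)" for u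
  have D: "u \<in> D" if "u \<in> L2 w" "E B u = u" for u
    using bounded_range_D[OF B that] .
  note fD [simp] = D[OF f]
  note [simp] = B(1) D_L2 L_L2 D_scale D_add D_diff L2_scale L2_add L2_diff E_L2
  have cancel: "x \<le> y" if "x * x \<le> y * x" "0 \<le> x" "0 \<le> y" for x y :: real
    using that by (cases "x = 0") auto
  have AL2: "A u \<in> L2 w" if "u \<in> D" for u
    using that by (simp add: A_def)
  have A_linear: "A (\<lambda>v. u v + z * x v) = (\<lambda>v. A u v + z * A x v)" if "u \<in> D" "x \<in> D" for u x z
    using that by (simp add: A_def laplace_add laplace_scale algebra_simps)
  \<comment> \<open>A f remains in the range of the bounded set B. It therefore lies in D, and the
    form bounds apply to it as well.\<close>
  have EA: "E B (A f) = A f"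
    using f by (simp add: A_def E_diff E_scale L_range)
  have AD [simp]: "A f \<in> D"
    using AL2[OF fD] EA by (rule D)
  have form: "l2_inner w (A u) u = l2_inner w (L u) u - of_real (a * (l2_norm w u)\<^sup>2)" if "u \<in> D" for u
    using that by (simp add: A_def inner_diff_left inner_scale_left inner_self)
  have nonneg: "0 \<le> Re (l2_inner w (A u) u)" if "u \<in> D" "E B u = u" for u
    using L_form_ge[of B a u] B(2) that by (force simp: form)
  have le: "Re (l2_inner w (A u) u) \<le> (b - a) * (l2_norm w u)\<^sup>2" if "u \<in> D" "E B u = u" for u
    using L_form_le[of B b u] B(2) that by (force simp: form left_diff_distrib)
  have sym: "l2_inner w (A u) x = l2_inner w u (A x)" if "u \<in> D" "x \<in> D" for u x
    using that by (simp add: A_def inner_diff_left inner_diff_right inner_scale_left inner_scale_right L_sym)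
  \<comment> \<open>The off-diagonal entry of the form at the pair f, A f is the squared norm of A
    f, the quantity to be bounded.\<close>
  have "(cmod (l2_inner w (A f) (A f)))\<^sup>2 \<le> Re (l2_inner w (A f) f) * Re (l2_inner w (A (A f)) (A f))"
  proof (rule cmod_sq_le_of_nonneg_quadratic)
    fix z
    let ?u = "\<lambda>v. f v + cnj z * A f v"
    have "E B ?u = ?u"
      using f EA by (simp add: E_add E_scale)
    then have "0 \<le> Re (l2_inner w (A ?u) ?u)"
      by (intro nonneg) simp_all
    also have "A ?u = (\<lambda>v. A f v + cnj z * A (A f) v)"
      by (rule A_linear) simp_all
    also have "l2_inner w (\<lambda>v. A f v + cnj z * A (A f) v) ?u =
       l2_inner w (A f) f + z * l2_inner w (A f) (A f) + cnj z * l2_inner w (A (A f)) f + cnj z * z * l2_inner w (A (A f)) (A f)"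
      using AL2[OF AD] by (simp add: inner_add_left inner_add_right inner_scale_left inner_scale_right algebra_simps)
    also have "l2_inner w (A (A f)) f = cnj (l2_inner w (A f) (A f))"
      using sym[OF AD fD] by (simp add: inner_self)
    finally show "0 \<le> Re (l2_inner w (A f) f) + 2 * Re (z * l2_inner w (A f) (A f)) + (cmod z)\<^sup>2 * Re (l2_inner w (A (A f)) (A f))"
      unfolding cmod_power2 by (simp add: algebra_simps power2_eq_square)
  qed
  also have "\<dots> \<le> ((b - a) * (l2_norm w f)\<^sup>2) * ((b - a) * (l2_norm w (A f))\<^sup>2)"
    by (intro mult_mono le order_trans[OF nonneg le] nonneg f EA AD fD)
  finally have "((l2_norm w (A f))\<^sup>2)\<^sup>2 \<le> ((b - a) * l2_norm w f)\<^sup>2 * (l2_norm w (A f))\<^sup>2"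
    by (simp add: inner_self power_mult_distrib power2_eq_square mult_ac norm_mult)
  then have "(l2_norm w (A f))\<^sup>2 * (l2_norm w (A f))\<^sup>2 \<le> ((b - a) * l2_norm w f)\<^sup>2 * (l2_norm w (A f))\<^sup>2"
    by (simp only: power2_eq_square[of "(l2_norm w (A f))\<^sup>2"])
  from cancel[OF this zero_le_power2 zero_le_power2]
  have "(l2_norm w (A f))\<^sup>2 \<le> ((b - a) * l2_norm w f)\<^sup>2" .
  \<comment> \<open>The form bounds force b - a \<ge> 0 once f is nonzero; the zero vector was split
    off because b < a is possible for it.\<close>
  moreover have "l2_norm w f > 0"
    using norm_eq_0D[OF f(1)] False by (auto simp: less_le)
  then have "b - a \<ge> 0"
    using order_trans[OF nonneg[OF fD f(2)] le[OF fD f(2)]] by (simp add: zero_le_mult_iff)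
  ultimately show ?thesis
    unfolding A_def by (auto intro: power2_le_imp_le[of _ "(b - a) * l2_norm w f"])
qed

lemma L_norm_ge:
  assumes B: "B \<in> sets borel" "B \<subseteq> {c..}" and f: "f \<in> D" "E B f = f"
  shows "c * l2_norm w f \<le> l2_norm w (L f)"
proof -
  have "c * (l2_norm w f)\<^sup>2 \<le> cmod (l2_inner w (L f) f)"
    using L_form_ge[OF B f] complex_Re_le_cmod by (rule order_trans)
  also have "\<dots> \<le> l2_norm w (L f) * l2_norm w f"
    using f by (intro Cauchy_Schwarz L_L2 D_L2)
  finally show ?thesis
    using norm_nonneg[of f] norm_nonneg[of "L f"] by (cases "l2_norm w f = 0") (auto simp: power2_eq_square)
qed

end

section \<open>Paley-Wiener spaces and the Cauchy problem\<close>

context laplace_spectral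
begin

text \<open>The remainder f - E B f is annihilated by E B and by E (- B), so its spectral measure
  has total mass 0.\<close>

lemma eq_range_of_null:
  assumes B: "B \<in> sets borel" and f: "f \<in> L2 w" and null: "emeasure (M f) (- B) = 0"
  shows "E B f = f"
proof -
  have "- B \<in> sets borel" using B by (rule borel_comp)
  note [simp] = this B f E_L2 L2_diff
  have "(l2_norm w (E (- B) f))\<^sup>2 = 0"
    using null by (simp add: emeasure_M ennreal_eq_0_iff)
  then have nB: "E (- B) f = (\<lambda>v. 0)"
    by (intro norm_eq_0D) simp_all
  let ?r = "\<lambda>v. f v - E B f v"
  have "E B ?r = (\<lambda>v. 0)"
    by (simp add: E_diff E_idem)
  moreover have "E (- B) ?r = (\<lambda>v. 0)"
    by (simp add: E_diff E_Int nB E_empty)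
  ultimately have "emeasure (M ?r) B + emeasure (M ?r) (- B) = 0"
    by (simp add: emeasure_M)
  then have "emeasure (M ?r) UNIV = 0"
    using plus_emeasure[of B "M ?r" "- B"] by simp
  then have "(l2_norm w ?r)\<^sup>2 = 0"
    by (simp add: emeasure_M E_UNIV ennreal_eq_0_iff)
  then have "?r = (\<lambda>v. 0)"
    by (intro norm_eq_0D) simp_all
  then show ?thesis
    by (auto simp: fun_eq_iff)
qed

section \<open>The Bernstein inequality and its converse\<close>

lemma E_negative:
  assumes e: "e > 0" and f: "f \<in> D" shows "E {..-e} f = (\<lambda>v. 0)"
proof -
  let ?u = "E {..-e} f"
  have u: "?u \<in> D" "E {..-e} ?u = ?u"
    using f by (simp_all add: E_D E_idem D_L2)
  have "0 \<le> - e * (l2_norm w ?u)\<^sup>2"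
    using L_nonneg[OF u(1)] L_form_le[OF _ _ u] by (rule order_trans) auto
  then have "(l2_norm w ?u)\<^sup>2 \<le> 0"
    using e by (simp add: mult_le_0_iff)
  then show ?thesis
    using u by (intro norm_eq_0D) (auto simp: D_L2)
qed

text \<open>On this spectral range \<Delta> stretches norms by at least \<omega> + e. Its n-th power
  would grow like (\<omega> + e)^n, against the assumed bound K \<omega>^n.\<close>

lemma E_above:
  assumes e: "e > 0" and \<omega>: "\<omega> \<ge> 0"
    and f: "\<And>n. (L ^^ n) f \<in> D" "\<And>n. l2_norm w ((L ^^ n) f) \<le> K * \<omega> ^ n"
  shows "E {\<omega> + e..} f = (\<lambda>v. 0)"
proof -
  let ?B = "{\<omega> + e..}"
  have fD: "f \<in> D" using f(1)[of 0] by simp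
  have pos: "\<omega> + e > 0" using e \<omega> by simp
  have iter: "(L ^^ n) (E ?B f) = E ?B ((L ^^ n) f)" for n
    by (induction n) (use f(1) in \<open>simp_all add: L_E\<close>)
  have low: "(\<omega> + e) ^ n * l2_norm w (E ?B f) \<le> l2_norm w (E ?B ((L ^^ n) f))" for n
  proof (induction n)
    case (Suc n)
    have "(\<omega> + e) ^ Suc n * l2_norm w (E ?B f) = (\<omega> + e) * ((\<omega> + e) ^ n * l2_norm w (E ?B f))"
      by simp
    also have "\<dots> \<le> (\<omega> + e) * l2_norm w (E ?B ((L ^^ n) f))"
      using pos Suc by (intro mult_left_mono) auto
    also have "\<dots> \<le> l2_norm w (L (E ?B ((L ^^ n) f)))"
      by (rule L_norm_ge[of ?B]) (simp_all add: f E_D E_idem D_L2)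
    also have "\<dots> = l2_norm w (E ?B ((L ^^ Suc n) f))"
      using f(1)[of n] by (simp add: L_E)
    finally show ?case .
  qed simp
  have "l2_norm w (E ?B f) \<le> K * (\<omega> / (\<omega> + e)) ^ n" for n
  proof -
    have "(\<omega> + e) ^ n * l2_norm w (E ?B f) \<le> K * \<omega> ^ n"
      using low[of n] E_norm_le[of ?B "(L ^^ n) f"] f(2)[of n] D_L2[OF f(1)[of n]] by simp
    then show ?thesis
      using pos by (simp add: power_divide field_simps)
  qed
  moreover have "(\<lambda>n. K * (\<omega> / (\<omega> + e)) ^ n) \<longlonglongrightarrow> K * 0"
    using e \<omega> pos by (intro tendsto_mult_left LIMSEQ_power_zero) (simp add: field_simps)
  ultimately have "l2_norm w (E ?B f) \<le> K * 0"
    by (intro tendsto_lowerbound[where F=sequentially]) auto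
  then show ?thesis
    using norm_nonneg[of "E ?B f"] by (intro norm_eq_0D E_L2 D_L2 fD) auto
qed

text \<open>The two vanishing lemmas need a positive gap from [0, \<omega>], so the complement is
  exhausted by countably many sets with gaps 1 / (n + 1), each of spectral measure 0.\<close>

lemma range_if_Bernstein:
  assumes \<omega>: "\<omega> \<ge> 0"
    and f: "\<And>n. (L ^^ n) f \<in> D" "\<And>n. l2_norm w ((L ^^ n) f) \<le> K * \<omega> ^ n"
  shows "E {0..\<omega>} f = f"
proof (rule eq_range_of_null)
  have fD: "f \<in> D" using f(1)[of 0] by simp
  then show "f \<in> L2 w" by (rule D_L2)
  let ?e = "\<lambda>n. 1 / real (Suc n)"
  have "- {0..\<omega>} \<subseteq> (\<Union>n. {..- ?e n}) \<union> (\<Union>n. {\<omega> + ?e n..})"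
  proof
    fix x assume x: "x \<in> - {0..\<omega>}"
    show "x \<in> (\<Union>n. {..- ?e n}) \<union> (\<Union>n. {\<omega> + ?e n..})"
    proof (cases "x < 0")
      case True
      then obtain n where "?e n < - x"
        using reals_Archimedean[of "- x"] by (auto simp: inverse_eq_divide)
      then show ?thesis by (intro UnI1 UN_I[of n]) auto
    next
      case False
      then have "x - \<omega> > 0" using x by auto
      then obtain n where "?e n < x - \<omega>"
        using reals_Archimedean[of "x - \<omega>"] by (auto simp: inverse_eq_divide)
      then show ?thesis by (intro UnI2 UN_I[of n]) auto
    qed
  qed
  moreover have "{..- ?e n} \<in> null_sets (M f)" for n
    using E_negative[OF _ fD, of "?e n"] D_L2[OF fD] by (simp add: null_sets_def emeasure_M)
  moreover have "{\<omega> + ?e n..} \<in> null_sets (M f)" for n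
    using E_above[OF _ \<omega> f, of "?e n"] D_L2[OF fD] by (simp add: null_sets_def emeasure_M)
  ultimately have "- {0..\<omega>} \<in> null_sets (M f)"
    by (intro null_sets_subset[of "(\<Union>n. {..- ?e n}) \<union> (\<Union>n. {\<omega> + ?e n..})" "M f" "- {0..\<omega>}"] null_sets.Un null_sets_UN) simp_all
  then show "emeasure (M f) (- {0..\<omega>}) = 0"
    by (rule null_setsD1)
qed simp

lemma Bernstein:
  assumes f: "f \<in> L2 w" "E {0..\<omega>} f = f" and \<omega>: "\<omega> \<ge> 0"
  shows "(L ^^ n) f \<in> D" "l2_norm w ((L ^^ n) f) \<le> l2_norm w f * \<omega> ^ n"
proof -
  \<comment> \<open>The range condition is carried along in the induction: it keeps each iterate in
    D and supplies the operator bound \<omega> for the next one.\<close>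
  have "(L ^^ n) f \<in> D \<and> E {0..\<omega>} ((L ^^ n) f) = (L ^^ n) f \<and> l2_norm w ((L ^^ n) f) \<le> l2_norm w f * \<omega> ^ n"
  proof (induction n)
    case 0
    then show ?case using f bounded_range_D[of "{0..\<omega>}" 0 \<omega> f] by simp
  next
    case (Suc n)
    let ?u = "(L ^^ n) f"
    have u: "?u \<in> D" "E {0..\<omega>} ?u = ?u" using Suc by auto
    then have Lu: "L ?u \<in> L2 w" "E {0..\<omega>} (L ?u) = L ?u"
      by (simp_all add: L_L2 L_range)
    have "l2_norm w (L ?u) \<le> \<omega> * l2_norm w ?u"
      using L_shift_norm_le[of "{0..\<omega>}" 0 \<omega> ?u] u by (simp add: D_L2)
    also have "\<dots> \<le> \<omega> * (l2_norm w f * \<omega> ^ n)"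
      using Suc \<omega> by (intro mult_left_mono) auto
    finally show ?case
      using Lu bounded_range_D[of "{0..\<omega>}" 0 \<omega> "L ?u"] by (simp add: mult_ac)
  qed
  then show "(L ^^ n) f \<in> D" "l2_norm w ((L ^^ n) f) \<le> l2_norm w f * \<omega> ^ n"
    by auto
qed

text \<open>Each element of \<^const>\<open>PW\<close> comes with its own resolution of the identity; the Bernstein
  inequality, which does not mention the resolution, transfers membership to \<open>E\<close>.\<close>

lemma PW_iff:
  assumes \<omega>: "\<omega> \<ge> 0"
  shows "f \<in> PW w D \<omega> \<longleftrightarrow> f \<in> L2 w \<and> E {0..\<omega>} f = f"
proof
  assume "f \<in> PW w D \<omega>"
  then obtain E' where f: "f \<in> L2 w" and E': "spectral_resolution w D L E'"
      "emeasure (spectral_measure w E' f) (- {0..\<omega>}) = 0"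
    by (auto simp: PW_def)
  interpret E': laplace_spectral w D E'
    by unfold_locales (fact domain E')+
  have "E' {0..\<omega>} f = f"
    using f E'(2) by (intro E'.eq_range_of_null) auto
  from E'.Bernstein[OF f this \<omega>] have "E {0..\<omega>} f = f"
    by (rule range_if_Bernstein[OF \<omega>])
  with f show "f \<in> L2 w \<and> E {0..\<omega>} f = f" by simp
next
  assume f: "f \<in> L2 w \<and> E {0..\<omega>} f = f"
  then have "E (- {0..\<omega>}) f = (\<lambda>v. 0)"
    by (intro E_range_disjoint[of _ "{0..\<omega>}"]) auto
  then have "emeasure (M f) (- {0..\<omega>}) = 0"
    using f by (simp add: emeasure_M)
  then show "f \<in> PW w D \<omega>"
    using f resolution by (auto simp: PW_def)
qed

section \<open>Conservation, uniqueness and localization of solutions\<close>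

lemma cauchy_D: "cauchy_solution w D f g \<Longrightarrow> g t \<in> D"
  and cauchy_0: "cauchy_solution w D f g \<Longrightarrow> g 0 = f"
  by (simp_all add: cauchy_solution_def)

definition cauchy_error :: "(real \<Rightarrow> 'v \<Rightarrow> complex) \<Rightarrow> real \<Rightarrow> real \<Rightarrow> 'v \<Rightarrow> complex" where
  "cauchy_error g t h = (\<lambda>v. (g (t + h) v - g t v) / of_real h - \<i> * L (g t) v)"

lemma cauchy_error_tendsto:
  "cauchy_solution w D f g \<Longrightarrow> ((\<lambda>h. l2_norm w (cauchy_error g t h)) \<longlongrightarrow> 0) (at 0)"
  by (simp add: cauchy_solution_def cauchy_error_def)

lemma cauchy_error_L2:
  assumes "cauchy_solution w D f g" shows "cauchy_error g t h \<in> L2 w"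
proof -
  have "(\<lambda>v. 1 / of_real h * (g (t + h) v - g t v) - \<i> * L (g t) v) \<in> L2 w"
    using cauchy_D[OF assms] by (intro L2_diff L2_scale D_L2 L_L2)
  then show ?thesis
    by (simp add: cauchy_error_def)
qed

lemma cauchy_increment:
  "h \<noteq> 0 \<Longrightarrow> g (t + h) = (\<lambda>v. g t v + of_real h * (\<i> * L (g t) v + cauchy_error g t h v))"
  by (auto simp: cauchy_error_def fun_eq_iff)

text \<open>Pairing with a fixed vector reduces norm differentiability to real calculus. Imaginary
  parts are covered by replacing k with -i k.\<close>

lemma cauchy_inner_deriv:
  assumes g: "cauchy_solution w D f g" and k: "k \<in> L2 w"
  shows "((\<lambda>t. Re (l2_inner w (g t) k)) has_real_derivative - Im (l2_inner w (L (g t)) k)) (at t)"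
  unfolding DERIV_def
proof (rule LIM_zero_cancel, rule Lim_null_comparison)
  note [simp] = k cauchy_D[OF g] D_L2 L_L2 L2_add L2_scale cauchy_error_L2[OF g]
  show "((\<lambda>h. l2_norm w (cauchy_error g t h) * l2_norm w k) \<longlongrightarrow> 0) (at 0)"
    using tendsto_mult_left_zero[OF cauchy_error_tendsto[OF g]] .
  have "norm ((Re (l2_inner w (g (t + h)) k) - Re (l2_inner w (g t) k)) / h - - Im (l2_inner w (L (g t)) k))
      \<le> l2_norm w (cauchy_error g t h) * l2_norm w k" if "h \<noteq> 0" for h
  proof -
    have "l2_inner w (g (t + h)) k = l2_inner w (g t) k + of_real h * (\<i> * l2_inner w (L (g t)) k + l2_inner w (cauchy_error g t h) k)"
      by (subst cauchy_increment[OF that]) (simp add: inner_add_left inner_scale_left)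
    then have "(Re (l2_inner w (g (t + h)) k) - Re (l2_inner w (g t) k)) / h - - Im (l2_inner w (L (g t)) k)
       = Re (l2_inner w (cauchy_error g t h) k)"
      using that by (simp add: field_simps)
    then show ?thesis
      using abs_Re_le_cmod Cauchy_Schwarz[of "cauchy_error g t h" k] by (metis cauchy_error_L2[OF g] k order_trans real_norm_def)
  qed
  then show "\<forall>\<^sub>F h in at 0. norm ((Re (l2_inner w (g (t + h)) k) - Re (l2_inner w (g t) k)) / h - - Im (l2_inner w (L (g t)) k))
      \<le> l2_norm w (cauchy_error g t h) * l2_norm w k"
    by (auto simp: eventually_at intro: exI[of _ 1])
qed

text \<open>The derivative of the squared norm is 2 Re of the inner product of g and i \<Delta> g,
  which is 0 because \<Delta> is symmetric.\<close>

lemma cauchy_norm: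
  assumes g: "cauchy_solution w D f g"
  shows "l2_norm w (g t) = l2_norm w f"
proof -
  note [simp] = cauchy_D[OF g] D_L2 L_L2 L2_add L2_scale cauchy_error_L2[OF g]
  let ?\<phi> = "\<lambda>t. (l2_norm w (g t))\<^sup>2"
  have "DERIV ?\<phi> t :> 0" for t
    unfolding DERIV_def
  proof (rule Lim_null_comparison)
    let ?e = "\<lambda>h. l2_norm w (cauchy_error g t h)"
    have "((\<lambda>h. 2 * (l2_norm w (g t) * ?e h) + \<bar>h\<bar> * (l2_norm w (L (g t)) + ?e h)\<^sup>2) \<longlongrightarrow> 
        2 * (l2_norm w (g t) * 0) + \<bar>0\<bar> * (l2_norm w (L (g t)) + 0)\<^sup>2) (at 0)"
      by (intro tendsto_intros cauchy_error_tendsto[OF g])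
    then show "((\<lambda>h. 2 * (l2_norm w (g t) * ?e h) + \<bar>h\<bar> * (l2_norm w (L (g t)) + ?e h)\<^sup>2) \<longlongrightarrow> 0) (at 0)"
      by simp
    have "norm ((?\<phi> (t + h) - ?\<phi> t) / h) \<le> 2 * (l2_norm w (g t) * ?e h) + \<bar>h\<bar> * (l2_norm w (L (g t)) + ?e h)\<^sup>2"
      if h: "h \<noteq> 0" for h
    proof -
      let ?q = "\<lambda>v. \<i> * L (g t) v + cauchy_error g t h v"
      have "?\<phi> (t + h) = ?\<phi> t + 2 * (h * Re (l2_inner w (g t) ?q)) + (\<bar>h\<bar> * l2_norm w ?q)\<^sup>2"
        by (subst cauchy_increment[OF h]) (simp add: norm_add_sq norm_scale inner_scale_right)
      then have "(?\<phi> (t + h) - ?\<phi> t) / h = 2 * Re (l2_inner w (g t) ?q) + h * (l2_norm w ?q)\<^sup>2"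
        using h by (simp add: field_simps power2_eq_square)
      also have "Re (l2_inner w (g t) ?q) = Re (l2_inner w (g t) (cauchy_error g t h))"
        using inner_commute[of "L (g t)" "g t"] L_sym[of "g t" "g t"]
        by (simp add: inner_add_right inner_scale_right complex_eq_iff)
      finally have "norm ((?\<phi> (t + h) - ?\<phi> t) / h) \<le> 2 * \<bar>Re (l2_inner w (g t) (cauchy_error g t h))\<bar> + \<bar>h\<bar> * (l2_norm w ?q)\<^sup>2"
        by (simp add: abs_mult order_trans[OF abs_triangle_ineq])
      moreover have "\<bar>Re (l2_inner w (g t) (cauchy_error g t h))\<bar> \<le> l2_norm w (g t) * ?e h"
        by (rule order_trans[OF abs_Re_le_cmod]) (simp add: Cauchy_Schwarz)
      moreover have "l2_norm w ?q \<le> l2_norm w (L (g t)) + ?e h"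
        using norm_triangle[of "\<lambda>v. \<i> * L (g t) v" "cauchy_error g t h"] by (simp add: norm_scale)
      then have "\<bar>h\<bar> * (l2_norm w ?q)\<^sup>2 \<le> \<bar>h\<bar> * (l2_norm w (L (g t)) + ?e h)\<^sup>2"
        by (intro mult_left_mono power_mono) auto
      ultimately show ?thesis by linarith
    qed
    then show "\<forall>\<^sub>F h in at 0. norm ((?\<phi> (t + h) - ?\<phi> t) / h) \<le> 2 * (l2_norm w (g t) * ?e h) + \<bar>h\<bar> * (l2_norm w (L (g t)) + ?e h)\<^sup>2"
      by (auto simp: eventually_at intro: exI[of _ 1])
  qed
  then have "?\<phi> t = ?\<phi> 0"
    by (intro DERIV_isconst_all) simp
  then show ?thesis
    using cauchy_0[OF g] by (simp add: power2_eq_iff_nonneg)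
qed

text \<open>E B commutes with \<Delta>, so it maps the remainder of g to that of the projected
  solution, and it does not increase its norm.\<close>

lemma cauchy_E:
  assumes g: "cauchy_solution w D f g" and B: "B \<in> sets borel"
  shows "cauchy_solution w D (E B f) (\<lambda>t. E B (g t))"
  unfolding cauchy_solution_def
proof (intro conjI allI)
  note [simp] = cauchy_D[OF g] D_L2 L_L2 L2_add L2_scale L2_diff B
  show "E B (g t) \<in> D" for t by (simp add: E_D)
  show "E B (g 0) = E B f" by (simp add: cauchy_0[OF g])
  fix t
  have *: "(\<lambda>v. (E B (g (t + h)) v - E B (g t) v) / of_real h - \<i> * L (E B (g t)) v) = E B (cauchy_error g t h)" for h
  proof -
    have "cauchy_error g t h = (\<lambda>v. 1 / of_real h * (g (t + h) v - g t v) - \<i> * L (g t) v)"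
      by (simp add: cauchy_error_def)
    then have "E B (cauchy_error g t h) = (\<lambda>v. 1 / of_real h * (E B (g (t + h)) v - E B (g t) v) - \<i> * E B (L (g t)) v)"
      by (simp add: E_diff E_scale[where a="1 / of_real h"] E_scale[where a=\<i>] del: times_divide_eq_left)
    then show ?thesis
      by (simp add: L_E)
  qed
  show "((\<lambda>h. l2_norm w (\<lambda>v. (E B (g (t + h)) v - E B (g t) v) / of_real h - \<i> * L (E B (g t)) v)) \<longlongrightarrow> 0) (at 0)"
    unfolding *
    using E_norm_le[OF B cauchy_error_L2[OF g]]
    by (intro Lim_null_comparison[OF _ cauchy_error_tendsto[OF g, of t]]) auto
qed

lemma cauchy_diff:
  assumes g: "cauchy_solution w D f g" and g': "cauchy_solution w D f' g'"
  shows "cauchy_solution w D (\<lambda>v. f v - f' v) (\<lambda>t v. g t v - g' t v)"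
  unfolding cauchy_solution_def
proof (intro conjI allI)
  note gD [simp] = cauchy_D[OF g] and g'D [simp] = cauchy_D[OF g']
  note [simp] = D_L2
  show "(\<lambda>v. g t v - g' t v) \<in> D" for t by (simp add: D_diff)
  show "(\<lambda>v. g 0 v - g' 0 v) = (\<lambda>v. f v - f' v)" by (simp add: cauchy_0[OF g] cauchy_0[OF g'])
  fix t
  have *: "(\<lambda>v. (g (t + h) v - g' (t + h) v - (g t v - g' t v)) / of_real h - \<i> * L (\<lambda>v. g t v - g' t v) v)
      = (\<lambda>v. cauchy_error g t h v - cauchy_error g' t h v)" for h
  proof
    fix v
    have "(g (t + h) v - g' (t + h) v - (g t v - g' t v)) / of_real h
        = (g (t + h) v - g t v) / of_real h - (g' (t + h) v - g' t v) / of_real h"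
      by (simp add: diff_divide_distrib)
    then show "(g (t + h) v - g' (t + h) v - (g t v - g' t v)) / of_real h - \<i> * L (\<lambda>v. g t v - g' t v) v
        = cauchy_error g t h v - cauchy_error g' t h v"
      by (simp only: cauchy_error_def laplace_diff[OF D_L2 D_L2] gD g'D right_diff_distrib) simp
  qed
  have "((\<lambda>h. l2_norm w (cauchy_error g t h) + l2_norm w (cauchy_error g' t h)) \<longlongrightarrow> 0) (at 0)"
    using tendsto_add[OF cauchy_error_tendsto[OF g] cauchy_error_tendsto[OF g']] by simp
  from Lim_null_comparison[OF always_eventually this, of "\<lambda>h. l2_norm w (\<lambda>v. cauchy_error g t h v - cauchy_error g' t h v)"]
  show "((\<lambda>h. l2_norm w (\<lambda>v. (g (t + h) v - g' (t + h) v - (g t v - g' t v)) / of_real h - \<i> * L (\<lambda>v. g t v - g' t v) v)) \<longlongrightarrow> 0) (at 0)"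
    unfolding * using norm_diff_triangle[OF cauchy_error_L2[OF g] cauchy_error_L2[OF g']] by simp
qed

text \<open>The difference solves the problem with initial value 0, and the norm is
  conserved.\<close>

lemma cauchy_unique:
  assumes g: "cauchy_solution w D f g" and g': "cauchy_solution w D f g'"
  shows "g t = g' t"
proof -
  have "l2_norm w (\<lambda>v. g t v - g' t v) = 0"
    using cauchy_norm[OF cauchy_diff[OF g g']] by simp
  then have "(\<lambda>v. g t v - g' t v) = (\<lambda>v. 0)"
    using cauchy_D[OF g] cauchy_D[OF g'] by (intro norm_eq_0D) (simp_all add: L2_diff D_L2)
  then show ?thesis by (auto simp: fun_eq_iff)
qed

lemma cauchy_range:
  assumes "cauchy_solution w D f g" "B \<in> sets borel" "E B f = f"
  shows "E B (g t) = g t"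
  using cauchy_unique[OF cauchy_E[OF assms(1,2)]] assms(1,3) by metis

text \<open>If \<open>\<Delta> g\<close> is close to \<open>a * g\<close> along the solution, then \<open>g t\<close> is close to \<open>exp (\<i> * a * t) * f\<close>:
  \<open>exp (- \<i> * a * t) * g t\<close> has small derivative, seen after pairing with a fixed vector.\<close>

lemma cauchy_approx_cis:
  assumes g: "cauchy_solution w D f g" and le: "\<And>t. l2_norm w (\<lambda>v. L (g t) v - of_real a * g t v) \<le> K"
  shows "l2_norm w (\<lambda>v. g t v - cis (a * t) * f v) \<le> K * \<bar>t\<bar>"
proof -
  note gD [simp] = cauchy_D[OF g]
  have fD [simp]: "f \<in> D" using cauchy_D[OF g, of 0] cauchy_0[OF g] by simp
  note [simp] = D_L2 L_L2 L2_add L2_scale L2_diff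
  \<comment> \<open>The pairing vector is the defect at the final time t, rotated back by a
    unimodular factor and kept fixed while s varies. It makes r t - r 0 equal to its squared
    norm.\<close>
  define k where "k = (\<lambda>v. cis (- (a * t)) * g t v - f v)"
  have k [simp]: "k \<in> L2 w" by (simp add: k_def)
  \<comment> \<open>Expanded into cosine and sine so that only derivatives of real parts of pairings
    occur.\<close>
  define r where "r s = cos (a * s) * Re (l2_inner w (g s) k) + sin (a * s) * - Re (l2_inner w (g s) (\<lambda>v. - \<i> * k v))" for s
  have ik: "l2_inner w x (\<lambda>v. - \<i> * k v) = \<i> * l2_inner w x k" for x
    by (subst inner_scale_right) simp
  have r: "r s = Re (l2_inner w (\<lambda>v. cis (- (a * s)) * g s v) k)" for s
    unfolding r_def ik by (simp add: inner_scale_left)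
  define r' where "r' s = - Im (cis (- (a * s)) * l2_inner w (\<lambda>v. L (g s) v - of_real a * g s v) k)" for s
  have "(r has_real_derivative r' s) (at s)" for s
  proof -
    have "(r has_real_derivative
        (cos (a * s) * (- Im (l2_inner w (L (g s)) k)) + (- sin (a * s) * a) * Re (l2_inner w (g s) k)) +
        (sin (a * s) * - (- Im (l2_inner w (L (g s)) (\<lambda>v. - \<i> * k v))) + cos (a * s) * a * - Re (l2_inner w (g s) (\<lambda>v. - \<i> * k v)))) (at s)"
      unfolding r_def[abs_def]
      by (rule derivative_eq_intros cauchy_inner_deriv[OF g] k L2_scale refl | simp add: algebra_simps)+
    also have "(cos (a * s) * (- Im (l2_inner w (L (g s)) k)) + (- sin (a * s) * a) * Re (l2_inner w (g s) k)) +
        (sin (a * s) * - (- Im (l2_inner w (L (g s)) (\<lambda>v. - \<i> * k v))) + cos (a * s) * a * - Re (l2_inner w (g s) (\<lambda>v. - \<i> * k v))) = r' s"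
      unfolding r'_def ik by (simp add: inner_diff_left inner_scale_left algebra_simps)
    finally show ?thesis .
  qed
  moreover have "norm (r' s) \<le> K * l2_norm w k" for s
  proof -
    have "norm (r' s) \<le> cmod (l2_inner w (\<lambda>v. L (g s) v - of_real a * g s v) k)"
      using abs_Im_le_cmod[of "cis (- (a * s)) * l2_inner w (\<lambda>v. L (g s) v - of_real a * g s v) k"]
      by (simp add: r'_def norm_mult)
    also have "\<dots> \<le> l2_norm w (\<lambda>v. L (g s) v - of_real a * g s v) * l2_norm w k"
      by (intro Cauchy_Schwarz) simp_all
    also have "\<dots> \<le> K * l2_norm w k"
      by (intro mult_right_mono le) simp
    finally show ?thesis .
  qed
  ultimately have "norm (r t - r 0) \<le> (K * l2_norm w k) * norm (t - 0)"
    by (intro field_differentiable_bound[of UNIV r r']) auto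
  moreover have "r t - r 0 = (l2_norm w k)\<^sup>2"
  proof -
    have "of_real ((l2_norm w k)\<^sup>2) = l2_inner w (\<lambda>v. cis (- (a * t)) * g t v) k - l2_inner w f k"
      unfolding inner_self[symmetric] by (subst (1) k_def) (simp add: inner_diff_left)
    then show ?thesis
      by (simp add: r cauchy_0[OF g] complex_eq_iff)
  qed
  ultimately have "l2_norm w k * l2_norm w k \<le> (K * \<bar>t\<bar>) * l2_norm w k"
    by (simp add: power2_eq_square mult_ac)
  moreover have "K \<ge> 0"
    using order_trans[OF norm_nonneg le] .
  ultimately have "l2_norm w k \<le> K * \<bar>t\<bar>"
    by (cases "l2_norm w k = 0") (auto intro: mult_right_le_imp_le simp: less_le)
  moreover have "(\<lambda>v. g t v - cis (a * t) * f v) = (\<lambda>v. cis (a * t) * k v)"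
    by (simp add: k_def algebra_simps cis_mult flip: mult.assoc)
  ultimately show ?thesis
    by (simp add: norm_scale)
qed

end

section \<open>Interpolation of solutions\<close>

text \<open>Dominated convergence for series: the M-test supplies one finite K whose tail is small
  for all n at once.\<close>

lemma infsum_tendsto_0:
  fixes a :: "'k \<Rightarrow> nat \<Rightarrow> complex"
  assumes le: "\<And>k n. k \<in> A \<Longrightarrow> cmod (a k n) \<le> m k" and m: "m summable_on A"
    and lim: "\<And>k. k \<in> A \<Longrightarrow> a k \<longlonglongrightarrow> 0"
  shows "(\<lambda>n. \<Sum>\<^sub>\<infinity>k\<in>A. a k n) \<longlonglongrightarrow> 0"
proof (rule tendstoI)
  fix e :: real assume e: "e > 0"
  have "uniform_limit UNIV (\<lambda>K n. \<Sum>k\<in>K. a k n) (\<lambda>n. \<Sum>\<^sub>\<infinity>k\<in>A. a k n) (finite_subsets_at_top A)"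
    using le m by (rule Weierstrass_m_test_general)
  then have "\<forall>\<^sub>F K in finite_subsets_at_top A. (\<forall>n\<in>UNIV. dist (\<Sum>k\<in>K. a k n) (\<Sum>\<^sub>\<infinity>k\<in>A. a k n) < e / 2) \<and> finite K \<and> K \<subseteq> A"
    using e by (intro eventually_conj uniform_limitD eventually_finite_subsets_at_top_weakI) auto
  from eventually_happens'[OF finite_subsets_at_top_neq_bot this]
  obtain K where K: "\<And>n. dist (\<Sum>k\<in>K. a k n) (\<Sum>\<^sub>\<infinity>k\<in>A. a k n) < e / 2" "finite K" "K \<subseteq> A"
    by auto
  have "(\<lambda>n. \<Sum>k\<in>K. a k n) \<longlonglongrightarrow> (\<Sum>k\<in>K. 0)"
    using K lim by (intro tendsto_sum) auto
  then have "\<forall>\<^sub>F n in sequentially. dist (\<Sum>k\<in>K. a k n) 0 < e / 2"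
    using e by (intro tendstoD) auto
  then show "\<forall>\<^sub>F n in sequentially. dist (\<Sum>\<^sub>\<infinity>k\<in>A. a k n) 0 < e"
  proof eventually_elim
    case (elim n)
    then show ?case
      using K(1)[of n] dist_triangle2[of "\<Sum>\<^sub>\<infinity>k\<in>A. a k n" 0 "\<Sum>k\<in>K. a k n"]
      using dist_triangle[of "\<Sum>\<^sub>\<infinity>k\<in>A. a k n" 0 "\<Sum>k\<in>K. a k n"] by (simp add: dist_commute)
  qed
qed

lemma has_sum_finite_sum:
  fixes f :: "'i \<Rightarrow> 'k \<Rightarrow> 'a::topological_comm_monoid_add"
  assumes "finite I" "\<And>i. i \<in> I \<Longrightarrow> (f i has_sum s i) A"
  shows "((\<lambda>k. \<Sum>i\<in>I. f i k) has_sum (\<Sum>i\<in>I. s i)) A"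
  using assms by (induction I rule: finite_induct) (auto intro: has_sum_add)

lemma has_sum_difference:
  fixes f g :: "'k \<Rightarrow> 'a::real_normed_vector"
  assumes "(f has_sum a) A" "(g has_sum b) A"
  shows "((\<lambda>x. f x - g x) has_sum (a - b)) A"
  using has_sum_add[OF assms(1), of "\<lambda>x. - g x" "- b"] assms(2) by (simp add: has_sum_uminus)

section \<open>Decomposition into spectral cells\<close>

definition cell :: "real \<Rightarrow> nat \<Rightarrow> real set" where
  "cell \<delta> j = {real j * \<delta>..<real (Suc j) * \<delta>}"

lemma cell_borel [simp, measurable]: "cell \<delta> j \<in> sets borel"
  by (simp add: cell_def)

lemma mem_cell_iff:
  assumes "\<delta> > 0" shows "x \<in> cell \<delta> j \<longleftrightarrow> \<lfloor>x / \<delta>\<rfloor> = int j"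
  using assms by (simp add: cell_def floor_eq_iff field_simps)

lemma disjoint_cells: "\<delta> > 0 \<Longrightarrow> i \<noteq> j \<Longrightarrow> cell \<delta> i \<inter> cell \<delta> j = {}"
  by (auto simp: mem_cell_iff)

text \<open>Cells are half-open, to be disjoint; the n-th one is included only to catch the right
  endpoint.\<close>

lemma interval_subset_cells:
  assumes "\<delta> > 0" shows "{0..real n * \<delta>} \<subseteq> (\<Union>j\<le>n. cell \<delta> j)"
proof
  fix x assume x: "x \<in> {0..real n * \<delta>}"
  let ?j = "nat \<lfloor>x / \<delta>\<rfloor>"
  have "x / \<delta> \<le> real n" "0 \<le> x / \<delta>"
    using x assms by (auto simp: field_simps)
  then have "\<lfloor>x / \<delta>\<rfloor> \<le> int n" "0 \<le> \<lfloor>x / \<delta>\<rfloor>"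
    by linarith+
  then have "x \<in> cell \<delta> ?j" "?j \<le> n"
    using assms by (simp_all add: mem_cell_iff)
  then show "x \<in> (\<Union>j\<le>n. cell \<delta> j)"
    by blast
qed

context laplace_spectral
begin

text \<open>Pythagoras for the orthogonal pieces, read off from additivity of the spectral measure
  of x.\<close>

lemma norm_sq_cells:
  assumes \<delta>: "\<delta> > 0" and x: "x \<in> L2 w" "E {0..real n * \<delta>} x = x"
  shows "(l2_norm w x)\<^sup>2 = (\<Sum>j\<le>n. (l2_norm w (E (cell \<delta> j) x))\<^sup>2)"
proof -
  have "E (\<Union>j\<le>n. cell \<delta> j) x = x"
    by (rule E_range_subset[OF _ _ x(1) interval_subset_cells[OF \<delta>] x(2)]) auto
  then have "ennreal ((l2_norm w x)\<^sup>2) = emeasure (M x) (\<Union>j\<le>n. cell \<delta> j)"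
    using x by (subst emeasure_M) auto
  also have "\<dots> = (\<Sum>j\<le>n. emeasure (M x) (cell \<delta> j))"
    using disjoint_cells[OF \<delta>] by (intro sum_emeasure[symmetric]) (auto simp: disjoint_family_on_def)
  also have "\<dots> = ennreal (\<Sum>j\<le>n. (l2_norm w (E (cell \<delta> j) x))\<^sup>2)"
    using x by (simp add: emeasure_M)
  finally show ?thesis
    by (simp add: sum_nonneg)
qed

text \<open>A relative error K on each cell gives the same relative error globally, with no loss in
  the number of cells, because squared norms add up over the cells.\<close>

lemma cells_approx:
  assumes \<delta>: "\<delta> > 0" and f: "f \<in> L2 w" "E {0..real n * \<delta>} f = f"
    and x: "x \<in> L2 w" "E {0..real n * \<delta>} x = x" and K: "K \<ge> 0"
    and le: "\<And>j. j \<le> n \<Longrightarrow>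
      l2_norm w (\<lambda>v. E (cell \<delta> j) x v - c j * E (cell \<delta> j) f v) \<le> K * l2_norm w (E (cell \<delta> j) f)"
  shows "l2_norm w (\<lambda>v. x v - (\<Sum>j\<le>n. c j * E (cell \<delta> j) f v)) \<le> K * l2_norm w f"
proof -
  let ?C = "cell \<delta>" and ?I = "{0..real n * \<delta>}"
  define s where "s = (\<lambda>v. \<Sum>j\<le>n. c j * E (?C j) f v)"
  note [simp] = f(1) x(1) E_L2 L2_scale L2_sum L2_diff
  have s [simp]: "s \<in> L2 w" by (simp add: s_def)
  have E_s: "E B s = (\<lambda>v. \<Sum>j\<le>n. c j * E B (E (?C j) f) v)" if "B \<in> sets borel" for B
  proof -
    have "E B (\<lambda>v. \<Sum>j\<in>J. c j * E (?C j) f v) = (\<lambda>v. \<Sum>j\<in>J. c j * E B (E (?C j) f) v)" if "finite J" for J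
      using that \<open>B \<in> sets borel\<close>
      by (induction J rule: finite_induct) (simp_all add: E_zero E_add E_scale)
    then show ?thesis by (simp add: s_def)
  qed
  have "E ?I (E (?C j) f) = E (?C j) f" for j
    using E_Int[of ?I "?C j" f] E_Int[of "?C j" ?I f] f(2) by (simp add: Int_commute)
  then have "E ?I s = s"
    by (simp add: E_s) (simp add: s_def)
  then have y: "E ?I (\<lambda>v. x v - s v) = (\<lambda>v. x v - s v)"
    using x(2) by (simp add: E_diff)
  have part: "E (?C j) (\<lambda>v. x v - s v) = (\<lambda>v. E (?C j) x v - c j * E (?C j) f v)" if j: "j \<le> n" for j
  proof -
    have "c i * E (?C j) (E (?C i) f) v = (if i = j then c j * E (?C j) f v else 0)" for i v
      using disjoint_cells[OF \<delta>, of j i] by (auto simp: E_Int E_idem E_empty)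
    then have "E (?C j) s = (\<lambda>v. c j * E (?C j) f v)"
      using j by (simp add: E_s)
    then show ?thesis by (simp add: E_diff)
  qed
  have "(l2_norm w (\<lambda>v. x v - s v))\<^sup>2 = (\<Sum>j\<le>n. (l2_norm w (E (?C j) (\<lambda>v. x v - s v)))\<^sup>2)"
    by (rule norm_sq_cells[OF \<delta> _ y]) simp
  also have "\<dots> \<le> (\<Sum>j\<le>n. (K * l2_norm w (E (?C j) f))\<^sup>2)"
    using le by (intro sum_mono power_mono) (auto simp: part)
  also have "\<dots> = (K * l2_norm w f)\<^sup>2"
    unfolding power_mult_distrib norm_sq_cells[OF \<delta> f] sum_distrib_left ..
  finally show ?thesis
    unfolding s_def by (rule power2_le_imp_le) (simp add: K)
qed

lemma cell_shift_le:
  assumes "\<delta> > 0" "f \<in> L2 w" "E (cell \<delta> j) f = f"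
  shows "l2_norm w (\<lambda>v. L f v - of_real (real j * \<delta>) * f v) \<le> \<delta> * l2_norm w f"
proof -
  have "cell \<delta> j \<subseteq> {real j * \<delta>..real (Suc j) * \<delta>}"
    by (auto simp: cell_def)
  from L_shift_norm_le[OF cell_borel this assms(2,3)] show ?thesis
    by (simp add: algebra_simps)
qed

lemma L_cells_approx:
  assumes \<delta>: "\<delta> > 0" and f: "f \<in> L2 w" "E {0..real n * \<delta>} f = f"
  shows "l2_norm w (\<lambda>v. L f v - (\<Sum>j\<le>n. of_real (real j * \<delta>) * E (cell \<delta> j) f v)) \<le> \<delta> * l2_norm w f"
proof (rule cells_approx[OF \<delta> f])
  have fD: "f \<in> D" using bounded_range_D[OF _ _ f] by auto
  show "L f \<in> L2 w" "E {0..real n * \<delta>} (L f) = L f"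
    using fD f by (simp_all add: L_L2 L_range)
  show "l2_norm w (\<lambda>v. E (cell \<delta> j) (L f) v - of_real (real j * \<delta>) * E (cell \<delta> j) f v) \<le> \<delta> * l2_norm w (E (cell \<delta> j) f)" for j
    using cell_shift_le[OF \<delta>, of "E (cell \<delta> j) f" j] f(1) fD by (simp add: L_E E_L2 E_idem)
qed (use \<delta> in simp)

lemma cauchy_cells_approx:
  assumes \<delta>: "\<delta> > 0" and f: "E {0..real n * \<delta>} f = f" and g: "cauchy_solution w D f g"
  shows "l2_norm w (\<lambda>v. g t v - (\<Sum>j\<le>n. cis (real j * \<delta> * t) * E (cell \<delta> j) f v)) \<le> \<delta> * \<bar>t\<bar> * l2_norm w f"
proof (rule cells_approx[OF \<delta> _ f])
  have fD: "f \<in> D" using cauchy_D[OF g, of 0] cauchy_0[OF g] by simp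
  then show "f \<in> L2 w" by (rule D_L2)
  show "g t \<in> L2 w" "E {0..real n * \<delta>} (g t) = g t"
    using cauchy_range[OF g _ f] cauchy_D[OF g] by (simp_all add: D_L2)
  fix j
  let ?C = "cell \<delta> j"
  have gj: "cauchy_solution w D (E ?C f) (\<lambda>t. E ?C (g t))"
    using g by (rule cauchy_E) simp
  \<comment> \<open>Norm conservation replaces the norm of the piece at time s by its initial norm,
    making the bound uniform in s.\<close>
  have "l2_norm w (\<lambda>v. L (E ?C (g s)) v - of_real (real j * \<delta>) * E ?C (g s) v) \<le> \<delta> * l2_norm w (E ?C f)" for s
    using cell_shift_le[OF \<delta>, of "E ?C (g s)" j] cauchy_norm[OF gj, of s] cauchy_D[OF g, of s]
    by (simp add: E_L2 E_idem D_L2)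
  from cauchy_approx_cis[OF gj this, of t]
  show "l2_norm w (\<lambda>v. E ?C (g t) v - cis (real j * \<delta> * t) * E ?C f v) \<le> \<delta> * \<bar>t\<bar> * l2_norm w (E ?C f)"
    by (simp add: mult_ac)
qed (use \<delta> in simp)

text \<open>Summed against the spectral cells, the scalar interpolation formula holds exactly for the
  approximants of \<open>g\<close>; the mesh then tends to 0.\<close>

lemma cauchy_interpolation:
  assumes \<omega>: "\<omega> > 0" and f: "E {0..\<omega>} f = f" and g: "cauchy_solution w D f g"
  defines "\<tau> \<equiv> \<lambda>t. \<omega> * t / pi"
  shows "(\<lambda>k::int. of_real (vt_coeff (\<tau> t) k) * g (of_int k * pi / \<omega>) v) summable_on - {0}" (is ?summable)
    and "g t v = of_real (sinc (\<tau> t)) * (f v + \<i> * of_real t * L f v)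
      + (\<Sum>\<^sub>\<infinity>k\<in>- {0}. of_real (vt_coeff (\<tau> t) k) * g (of_int k * pi / \<omega>) v)" (is ?formula)
proof -
  have fD: "f \<in> D" using cauchy_D[OF g, of 0] cauchy_0[OF g] by simp
  then have fL2: "f \<in> L2 w" by (rule D_L2)
  define C where "C = l2_norm w f / sqrt (vdeg w v)"
  have C: "C \<ge> 0" using vdeg_pos[of v] by (simp add: C_def)
  define c where "c k = vt_coeff (\<tau> t) k" for k
  define p where "p k = of_int k * pi / \<omega>" for k :: int
  \<comment> \<open>This mesh makes \<omega> a multiple of \<delta>; the last index j = n + 1 is the
    frequency \<omega> itself.\<close>
  define \<delta> where "\<delta> n = \<omega> / real (Suc n)" for n
  define G where "G n s = (\<Sum>j\<le>Suc n. cis (real j * \<delta> n * s) * E (cell (\<delta> n) j) f v)" for n s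
  define H where "H n = (\<Sum>j\<le>Suc n. of_real (real j * \<delta> n) * E (cell (\<delta> n) j) f v)" for n
  have \<delta>: "\<delta> n > 0" "real (Suc n) * \<delta> n = \<omega>" for n
    using \<omega> by (simp_all add: \<delta>_def)
  have "(\<lambda>n. inverse (real (Suc n))) \<longlonglongrightarrow> 0"
    by (rule LIMSEQ_inverse_real_of_nat)
  then have \<delta>0: "\<delta> \<longlonglongrightarrow> 0"
    unfolding \<delta>_def[abs_def] divide_inverse using tendsto_mult_right_zero by blast
  have f': "E {0..real (Suc n) * \<delta> n} f = f" for n
    using f by (simp only: \<delta>(2))
  have pw: "cmod (x v) \<le> K * C" if "x \<in> L2 w" "l2_norm w x \<le> K * l2_norm w f" for x K
    using order_trans[OF pointwise_le_norm[OF that(1)] divide_right_mono[OF that(2)]] vdeg_pos[of v]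
    by (simp add: C_def less_imp_le)
  have g_le: "cmod (g s v) \<le> C" for s
    using pw[of "g s" 1] cauchy_norm[OF g] cauchy_D[OF g] by (simp add: D_L2)
  have G_approx: "cmod (g s v - G n s) \<le> \<delta> n * \<bar>s\<bar> * C" for n s
    unfolding G_def using cauchy_cells_approx[OF \<delta>(1) f' g]
    by (intro pw[of "\<lambda>v. g s v - (\<Sum>j\<le>Suc n. cis (real j * \<delta> n * s) * E (cell (\<delta> n) j) f v)"] L2_diff L2_sum L2_scale E_L2 fL2 D_L2[OF cauchy_D[OF g]]) simp_all
  have H_approx: "cmod (L f v - H n) \<le> \<delta> n * C" for n
    unfolding H_def using L_cells_approx[OF \<delta>(1) fL2 f'] fL2 fD
    by (intro pw[of "\<lambda>v. L f v - (\<Sum>j\<le>Suc n. of_real (real j * \<delta> n) * E (cell (\<delta> n) j) f v)"] L2_diff L2_sum L2_scale E_L2 L_L2) simp_all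
  \<comment> \<open>The error bound \<delta> |s| C grows linearly at the sample times, too fast for
    coefficients of order 1/k^2. A bound on the approximants uniform in s is needed for domination;
    it is \<open>cells_approx\<close> with x = 0 and K = 1.\<close>
  have "l2_norm w (\<lambda>v. \<Sum>j\<le>Suc n. cis (real j * \<delta> n * s) * E (cell (\<delta> n) j) f v) \<le> l2_norm w f" for n s
  proof -
    have "l2_norm w (\<lambda>v. 0 - (\<Sum>j\<le>Suc n. cis (real j * \<delta> n * s) * E (cell (\<delta> n) j) f v)) \<le> 1 * l2_norm w f"
      by (rule cells_approx[OF \<delta>(1) fL2 f' L2_zero])
         (simp_all only: norm_minus_commute[of "\<lambda>v. 0"] norm_scale norm_cis diff_zero E_zero cell_borel atLeastAtMost_borel zero_le_one mult_1 order_refl)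
    then show ?thesis
      by (simp only: norm_minus_commute[of "\<lambda>v. 0"] diff_zero mult_1)
  qed
  then have "cmod (G n s) \<le> 1 * C" for n s
    unfolding G_def
    by (intro pw[of "\<lambda>v. \<Sum>j\<le>Suc n. cis (real j * \<delta> n * s) * E (cell (\<delta> n) j) f v"] L2_sum L2_scale E_L2 fL2) simp_all
  then have G_le: "cmod (G n s) \<le> C" for n s
    by simp
  have G_lim: "(\<lambda>n. g s v - G n s) \<longlonglongrightarrow> 0" for s
  proof (rule Lim_null_comparison)
    show "(\<lambda>n. \<delta> n * \<bar>s\<bar> * C) \<longlonglongrightarrow> 0"
      using \<delta>0 by (intro tendsto_mult_left_zero)
  qed (simp add: G_approx)
  have H_lim: "(\<lambda>n. L f v - H n) \<longlonglongrightarrow> 0"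
  proof (rule Lim_null_comparison)
    show "(\<lambda>n. \<delta> n * C) \<longlonglongrightarrow> 0"
      using \<delta>0 by (rule tendsto_mult_left_zero)
  qed (simp add: H_approx)
  have G_lim': "(\<lambda>n. G n s) \<longlonglongrightarrow> g s v" for s
    using tendsto_diff[OF tendsto_const[of "g s v"] G_lim[of s]] by simp
  have H_lim': "H \<longlonglongrightarrow> L f v"
    using tendsto_diff[OF tendsto_const[of "L f v"] H_lim] by simp
  have c_summable: "(\<lambda>k. \<bar>c k\<bar> * K) summable_on - {0}" for K
    unfolding c_def by (intro summable_on_cmult_left summable_on_vt_coeff)
  have "(\<lambda>k. norm (of_real (c k) * g (p k) v)) summable_on - {0}"
    by (rule summable_on_comparison_test[OF c_summable[of C]]) (auto simp: norm_mult intro: mult_left_mono g_le)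
  then have summable: "(\<lambda>k. of_real (c k) * g (p k) v) summable_on - {0}"
    by (rule abs_summable_summable)
  then show ?summable by (simp add: c_def p_def)
  have exact: "((\<lambda>k. of_real (c k) * G n (p k)) has_sum
      (G n t - of_real (sinc (\<tau> t)) * (G n 0 + \<i> * of_real t * H n))) (- {0})" for n
  proof -
    let ?x = "\<lambda>j. real j * \<delta> n" and ?f = "\<lambda>j. E (cell (\<delta> n) j) f v"
    have "((\<lambda>k. of_real (c k) * cis (?x j * p k) * ?f j) has_sum
        ((cis (?x j * t) - of_real (sinc (\<tau> t)) * (1 + \<i> * of_real (?x j * t))) * ?f j)) (- {0})"
      if "j \<le> Suc n" for j
    proof (rule has_sum_cmult_left)
      \<comment> \<open>The frequency j \<delta> divided by \<omega> is the Fourier variable; j = n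
        + 1 reaches the endpoint 1, where \<open>has_sum_vt_cis\<close> still holds.\<close>
      have "?x j \<le> \<omega>"
        using that \<delta>(1)[of n] mult_right_mono[of "real j" "real (Suc n)" "\<delta> n"] by (simp add: \<delta>(2) del: of_nat_Suc)
      moreover have "0 \<le> ?x j"
        using \<delta>(1)[of n] by (simp add: less_imp_le)
      ultimately have "?x j / \<omega> \<in> {-1..1}"
        using \<omega> by (auto simp: field_simps intro: order_trans[of _ 0])
      from has_sum_vt_cis[OF this, of "\<tau> t"]
      show "((\<lambda>k. of_real (c k) * cis (?x j * p k)) has_sum
          (cis (?x j * t) - of_real (sinc (\<tau> t)) * (1 + \<i> * of_real (?x j * t)))) (- {0})"
        using \<omega> by (simp add: c_def p_def \<tau>_def mult_ac)
    qed
    then have "((\<lambda>k. \<Sum>j\<le>Suc n. of_real (c k) * cis (?x j * p k) * ?f j) has_sum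
        (\<Sum>j\<le>Suc n. (cis (?x j * t) - of_real (sinc (\<tau> t)) * (1 + \<i> * of_real (?x j * t))) * ?f j)) (- {0})"
      by (intro has_sum_finite_sum) auto
    also have "(\<lambda>k. \<Sum>j\<le>Suc n. of_real (c k) * cis (?x j * p k) * ?f j) = (\<lambda>k. of_real (c k) * G n (p k))"
      by (simp add: G_def sum_distrib_left mult.assoc del: sum.atMost_Suc)
    also have "(\<Sum>j\<le>Suc n. (cis (?x j * t) - of_real (sinc (\<tau> t)) * (1 + \<i> * of_real (?x j * t))) * ?f j)
        = G n t - of_real (sinc (\<tau> t)) * (G n 0 + \<i> * of_real t * H n)"
      by (simp add: G_def H_def sum_distrib_left sum_subtractf sum.distrib algebra_simps del: sum.atMost_Suc)
    finally show ?thesis .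
  qed
  have lim: "(\<lambda>n. \<Sum>\<^sub>\<infinity>k\<in>- {0}. of_real (c k) * (g (p k) v - G n (p k))) \<longlonglongrightarrow> 0"
  proof (rule infsum_tendsto_0)
    show "(\<lambda>k. \<bar>c k\<bar> * (C + C)) summable_on - {0}" by (rule c_summable)
    show "cmod (of_real (c k) * (g (p k) v - G n (p k))) \<le> \<bar>c k\<bar> * (C + C)" for k n
      unfolding norm_mult norm_of_real
      by (intro mult_left_mono order_trans[OF norm_triangle_ineq4] add_mono g_le G_le) simp
    show "(\<lambda>n. of_real (c k) * (g (p k) v - G n (p k))) \<longlonglongrightarrow> 0" for k
      by (intro tendsto_mult_right_zero G_lim)
  qed
  \<comment> \<open>Since the approximants satisfy the formula exactly, the dominated series equals
    the error of the formula for g up to terms that converge.\<close>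
  have defect: "(\<Sum>\<^sub>\<infinity>k\<in>- {0}. of_real (c k) * (g (p k) v - G n (p k)))
      = (\<Sum>\<^sub>\<infinity>k\<in>- {0}. of_real (c k) * g (p k) v) - (G n t - of_real (sinc (\<tau> t)) * (G n 0 + \<i> * of_real t * H n))" for n
    unfolding right_diff_distrib[of "of_real (c _)"]
    by (intro infsumI has_sum_difference has_sum_infsum summable exact)
  have "(\<lambda>n. (\<Sum>\<^sub>\<infinity>k\<in>- {0}. of_real (c k) * g (p k) v) - (G n t - of_real (sinc (\<tau> t)) * (G n 0 + \<i> * of_real t * H n)))
     \<longlonglongrightarrow> (\<Sum>\<^sub>\<infinity>k\<in>- {0}. of_real (c k) * g (p k) v) - (g t v - of_real (sinc (\<tau> t)) * (g 0 v + \<i> * of_real t * L f v))"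
    using G_lim' H_lim' by (intro tendsto_intros)
  from LIMSEQ_unique[OF this lim[unfolded defect]]
  have "(\<Sum>\<^sub>\<infinity>k\<in>- {0}. of_real (c k) * g (p k) v) = g t v - of_real (sinc (\<tau> t)) * (g 0 v + \<i> * of_real t * L f v)"
    by simp
  then show ?formula
    using cauchy_0[OF g] by (simp add: c_def p_def algebra_simps)
qed

section \<open>Determination by samples and frame reconstruction\<close>

lemma PW_diff:
  assumes "\<omega> > 0" "f \<in> PW w D \<omega>" "g \<in> PW w D \<omega>"
  shows "(\<lambda>v. f v - g v) \<in> PW w D \<omega>"
  using assms by (simp add: PW_iff L2_diff E_diff)

lemma cauchy_eq_if_eq_on_sampling_set:
  assumes \<omega>: "\<omega> > 0" and f: "f \<in> PW w D \<omega>" "f' \<in> PW w D \<omega>" and S: "sampling_set w D \<omega> S"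
    and g: "cauchy_solution w D f g" "cauchy_solution w D f' g'" and eq: "\<And>s. s \<in> S \<Longrightarrow> f s = f' s"
  shows "g t = g' t"
proof -
  let ?d = "\<lambda>v. f v - f' v"
  have d: "?d \<in> PW w D \<omega>"
    using PW_diff[OF \<omega> f] .
  obtain c where "c > 0" and c: "c * (l2_norm w ?d)\<^sup>2 \<le> (\<Sum>\<^sub>\<infinity>s\<in>S. (cmod (?d s))\<^sup>2)"
    using S d unfolding sampling_set_def by blast
  have "(\<Sum>\<^sub>\<infinity>s\<in>S. (cmod (?d s))\<^sup>2) = 0"
    by (rule infsum_0) (simp add: eq)
  with \<open>c > 0\<close> c have "l2_norm w ?d = 0"
    by (simp add: mult_le_0_iff)
  then have "?d = (\<lambda>v. 0)"
    using d by (intro norm_eq_0D) (auto simp: PW_def)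
  then have "f = f'"
    by (auto simp: fun_eq_iff)
  with g show ?thesis
    using cauchy_unique by blast
qed

lemma cauchy_reconstruction:
  fixes t :: real
  assumes \<omega>: "\<omega> > 0" and f: "f \<in> PW w D \<omega>" and g: "cauchy_solution w D f g"
    and \<Phi>: "reconstructing (PW w D \<omega>) S \<Phi>"
  defines "\<tau> \<equiv> \<omega> * t / pi"
  defines "h1 \<equiv> \<lambda>s. \<i> * of_real t * of_real (sinc \<tau>) * L f s + of_real (sinc \<tau>) * g 0 s"
  defines "h2 \<equiv> \<lambda>s. \<Sum>\<^sub>\<infinity>k\<in>- {0::int}. of_real (vt_coeff \<tau> k) * g (of_int k * pi / \<omega>) s"
  shows "((\<lambda>s. h1 s * \<Phi> s v) has_sum h1 v) S"
    and "((\<lambda>s. h2 s * \<Phi> s v) has_sum h2 v) S"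
    and "g t v = h1 v + h2 v"
proof -
  have Ef: "f \<in> L2 w" "E {0..\<omega>} f = f"
    using f \<omega> by (simp_all add: PW_iff)
  have fD: "f \<in> D"
    using bounded_range_D[OF _ _ Ef] by auto
  have sum: "g t v = h1 v + h2 v" for v
    using cauchy_interpolation(2)[OF \<omega> Ef(2) g, of t v] cauchy_0[OF g]
    by (simp add: h1_def h2_def \<tau>_def algebra_simps)
  have gt: "g t \<in> PW w D \<omega>"
    using cauchy_range[OF g _ Ef(2)] cauchy_D[OF g] \<omega> by (simp add: PW_iff D_L2)
  have h1: "h1 \<in> PW w D \<omega>"
    using Ef fD \<omega> unfolding h1_def cauchy_0[OF g]
    by (simp add: PW_iff L2_add L2_scale L_L2 E_add E_scale L_range)
  \<comment> \<open>h2 is given by a vertexwise series; its membership in the Paley-Wiener space is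
    obtained from g t and h1, which lie there.\<close>
  have "h2 = (\<lambda>v. g t v - h1 v)"
    by (simp add: sum)
  with PW_diff[OF \<omega> gt h1] have h2: "h2 \<in> PW w D \<omega>"
    by simp
  show "((\<lambda>s. h1 s * \<Phi> s v) has_sum h1 v) S" "((\<lambda>s. h2 s * \<Phi> s v) has_sum h2 v) S"
    using \<Phi> h1 h2 unfolding reconstructing_def by blast+
  show "g t v = h1 v + h2 v"
    by (rule sum)
qed

end

theorem mainTheorem1:
  fixes w :: "'v::countable \<Rightarrow> 'v \<Rightarrow> real"
    and D :: "('v \<Rightarrow> complex) set"
    and \<omega> :: real
    and S :: "'v set"
    and f :: "'v \<Rightarrow> complex"
    and g :: "real \<Rightarrow> 'v \<Rightarrow> complex"
  assumes "weighted_graph w"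
    and "laplace_domain w D"
    and "\<omega> > 0"
    and "f \<in> PW w D \<omega>"
    and "sampling_set w D \<omega> S"
    and "cauchy_solution w D f g"
  shows "(\<forall>f'\<in>PW w D \<omega>. \<forall>g'. cauchy_solution w D f' g' \<longrightarrow>
            (\<forall>s\<in>S. laplace w f' s = laplace w f s) \<longrightarrow>
            (\<forall>k::nat. \<forall>s\<in>S. g' (real k * pi / \<omega>) s = g (real k * pi / \<omega>) s) \<longrightarrow>
            (\<forall>t v. g' t v = g t v)) \<and>
         (\<forall>\<Phi>. frame_in w (PW w D \<omega>) S \<Phi> \<and> reconstructing (PW w D \<omega>) S \<Phi> \<longrightarrow>
            (\<forall>t v.
               (let c1 = (\<lambda>s. \<i> * of_real t * of_real (sinc (\<omega> * t / pi)) * laplace w f s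
                              + of_real (sinc (\<omega> * t / pi)) * g 0 s);
                    a = (\<lambda>s (k::int). of_real (\<omega> * t / (of_int k * pi) * sinc (\<omega> * t / pi - of_int k))
                              * g (of_int k * pi / \<omega>) s);
                    c2 = (\<lambda>s. \<Sum>\<^sub>\<infinity>k\<in>- {0}. a s k)
                in (\<forall>s\<in>S. a s summable_on (- {0})) \<and>
                   (\<lambda>s. c1 s * \<Phi> s v) summable_on S \<and>
                   (\<lambda>s. c2 s * \<Phi> s v) summable_on S \<and>
                   g t v = (\<Sum>\<^sub>\<infinity>s\<in>S. c1 s * \<Phi> s v) + (\<Sum>\<^sub>\<infinity>s\<in>S. c2 s * \<Phi> s v))))"
proof -
  \<comment> \<open>Membership of f in \<open>PW\<close> supplies the resolution of the identity
    used throughout.\<close>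
  from \<open>f \<in> PW w D \<omega>\<close> obtain E where E: "spectral_resolution w D (laplace w) E"
    by (auto simp: PW_def)
  interpret laplace_spectral w D E
    using assms(1,2) E by unfold_locales
  have uniqueness: "g' t v = g t v"
    if f': "f' \<in> PW w D \<omega>" and g': "cauchy_solution w D f' g'"
      and eq: "\<forall>k::nat. \<forall>s\<in>S. g' (real k * pi / \<omega>) s = g (real k * pi / \<omega>) s" for f' g' t v
  proof -
    have "f' s = f s" if "s \<in> S" for s
      using spec[OF eq, of 0] that cauchy_0[OF g'] cauchy_0[OF assms(6)] by simp
    then show ?thesis
      using cauchy_eq_if_eq_on_sampling_set[OF assms(3) f' assms(4,5) g' assms(6)] by simp
  qed
  have coeff: "of_real (\<omega> * t / (of_int k * pi) * sinc (\<omega> * t / pi - of_int k)) = complex_of_real (vt_coeff (\<omega> * t / pi) k)" for t k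
    by (simp add: vt_coeff_def mult.commute)
  have Ef: "E {0..\<omega>} f = f"
    using assms(3,4) by (simp add: PW_iff)
  show ?thesis
    unfolding Let_def coeff
  proof (intro conjI ballI allI impI)
    show "g' t v = g t v"
      if "f' \<in> PW w D \<omega>" "cauchy_solution w D f' g'"
        "\<forall>k::nat. \<forall>s\<in>S. g' (real k * pi / \<omega>) s = g (real k * pi / \<omega>) s" for f' g' t v
      using uniqueness that by blast
  next
    fix \<Phi> t s
    show "(\<lambda>k. complex_of_real (vt_coeff (\<omega> * t / pi) k) * g (real_of_int k * pi / \<omega>) s) summable_on - {0}"
      by (rule cauchy_interpolation(1)[OF assms(3) Ef assms(6)])
  next
    fix \<Phi> t v
    assume "frame_in w (PW w D \<omega>) S \<Phi> \<and> reconstructing (PW w D \<omega>) S \<Phi>"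
    then have \<Phi>: "reconstructing (PW w D \<omega>) S \<Phi>" ..
    note rec = cauchy_reconstruction[OF assms(3,4,6) \<Phi>, of t v]
    let ?c1 = "\<lambda>s. \<i> * of_real t * of_real (sinc (\<omega> * t / pi)) * laplace w f s + of_real (sinc (\<omega> * t / pi)) * g 0 s"
    let ?c2 = "\<lambda>s. \<Sum>\<^sub>\<infinity>k\<in>- {0::int}. of_real (vt_coeff (\<omega> * t / pi) k) * g (of_int k * pi / \<omega>) s"
    show "(\<lambda>s. ?c1 s * \<Phi> s v) summable_on S" "(\<lambda>s. ?c2 s * \<Phi> s v) summable_on S"
      using rec(1,2) by (auto intro: has_sum_imp_summable)
    show "g t v = (\<Sum>\<^sub>\<infinity>s\<in>S. ?c1 s * \<Phi> s v) + (\<Sum>\<^sub>\<infinity>s\<in>S. ?c2 s * \<Phi> s v)"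
      unfolding infsumI[OF rec(1)] infsumI[OF rec(2)] by (rule rec(3))
  qed
qed

end
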